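(* Let $k$ be a finite field of characteristic $p$, let $G$ be a profinite group, let $U$ be a finitely generated profinite $k[[G]]$-module, and let $H$ be a closed subgroup of $G$. Then $U$ is relatively $H$-projective if and only if $U$ is relatively $HN$-projective for every open normal subgroup $N$ of $G$.
   Context: Conventions: $k[[G]]=\varprojlim_{N} k[G/N]$ ($N$ over open normal subgroups of $G$) is the completed group algebra. Modules are profinite left modules; homomorphisms are continuous. For a closed subgroup $H\le G$, a profinite $k[[G]]$-module $U$ is relatively $H$-projective if for every continuous epimorphism $\beta:V\twoheadrightarrow W$ and continuous homomorphism $\varphi:U\to W$ of profinite $k[[G]]$-modules, there exists a continuous $k[[G]]$-homomorphism $\rho:U\to V$ with $\beta\rho=\varphi$ provided there is a continuous $k[[H]]$-homomorphism with this property. *)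

theory Defs
  imports "HOL-Analysis.Analysis" "HOL-Algebra.Module" "HOL-Algebra.Coset"
begin

section \<open>Profinite groups\<close>

locale profinite_group = group G for G :: "('g, 'n) monoid_scheme" (structure) and T :: "'g topology" +
  assumes topspace_eq: "topspace T = carrier G"
    and continuous_mult: "continuous_map (prod_topology T T) T (\<lambda>(x, y). x \<otimes> y)"
    and continuous_inv: "continuous_map T T (\<lambda>x. inv x)"
    and compact: "compact_space T"
    and Hausdorff: "Hausdorff_space T"
    and totally_disconnected: "connectedin T S \<Longrightarrow> \<exists>a. S \<subseteq> {a}"

definition open_normal :: "('g, 'm) monoid_scheme \<Rightarrow> 'g topology \<Rightarrow> 'g set set" where
  "open_normal G T = {N. N \<lhd> G \<and> openin T N}"


section \<open>Group algebras and completed group algebras\<close>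

text \<open>Elements of the group algebra of \<open>Q\<close> are the finitely supported functions on
  \<open>carrier Q\<close>, extended by zero.\<close>

definition group_algebra :: "('q, 'm) monoid_scheme \<Rightarrow> ('q \<Rightarrow> 'k::comm_ring_1) ring" where
  "group_algebra Q =
    \<lparr>carrier = {f. finite {x. f x \<noteq> 0} \<and> {x. f x \<noteq> 0} \<subseteq> carrier Q},
     monoid.mult = (\<lambda>f g z. \<Sum>x | f x \<noteq> 0. \<Sum>y | g y \<noteq> 0.
        if x \<otimes>\<^bsub>Q\<^esub> y = z then f x * g y else 0),
     monoid.one = (\<lambda>z. if z = \<one>\<^bsub>Q\<^esub> then 1 else 0),
     ring.zero = (\<lambda>_. 0),
     ring.add = (\<lambda>f g z. f z + g z)\<rparr>"

text \<open>The \<open>k\<close>-linear extension of a map \<open>h\<close> between groups to their group algebras.\<close>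

definition group_algebra_map :: "('q \<Rightarrow> 'r) \<Rightarrow> ('q \<Rightarrow> 'k::comm_ring_1) \<Rightarrow> 'r \<Rightarrow> 'k" where
  "group_algebra_map h f = (\<lambda>y. \<Sum>x | f x \<noteq> 0 \<and> h x = y. f x)"

text \<open>\<open>k[[G]]\<close> is the inverse limit of the \<open>k[G/N]\<close>: compatible families indexed by the open
  normal subgroups.  For \<open>M \<subseteq> N\<close> the projection \<open>G/M \<rightarrow> G/N\<close> sends a coset \<open>C\<close> to \<open>N C\<close>.\<close>

definition completed_group_algebra ::
    "('g, 'm) monoid_scheme \<Rightarrow> 'g topology \<Rightarrow> ('g set \<Rightarrow> 'g set \<Rightarrow> 'k::comm_ring_1) ring" where
  "completed_group_algebra G T =
    \<lparr>carrier = {x \<in> (\<Pi>\<^sub>E N \<in> open_normal G T. carrier (group_algebra (G Mod N))).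
        \<forall>M \<in> open_normal G T. \<forall>N \<in> open_normal G T. M \<subseteq> N \<longrightarrow>
          group_algebra_map (\<lambda>C. N <#>\<^bsub>G\<^esub> C) (x M) = x N},
     monoid.mult = (\<lambda>x y. \<lambda>N \<in> open_normal G T. x N \<otimes>\<^bsub>group_algebra (G Mod N)\<^esub> y N),
     monoid.one = (\<lambda>N \<in> open_normal G T. \<one>\<^bsub>group_algebra (G Mod N)\<^esub>),
     ring.zero = (\<lambda>N \<in> open_normal G T. \<zero>\<^bsub>group_algebra (G Mod N)\<^esub>),
     ring.add = (\<lambda>x y. \<lambda>N \<in> open_normal G T. x N \<oplus>\<^bsub>group_algebra (G Mod N)\<^esub> y N)\<rparr>"

text \<open>The inverse limit topology.  Each \<open>k[G/N]\<close> is discrete, which is the intended topology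
  for finite \<open>k\<close>.\<close>

definition completed_group_algebra_topology ::
    "('g, 'm) monoid_scheme \<Rightarrow> 'g topology \<Rightarrow> ('g set \<Rightarrow> 'g set \<Rightarrow> 'k::comm_ring_1) topology" where
  "completed_group_algebra_topology G T =
    subtopology
      (product_topology (\<lambda>N. discrete_topology (carrier (group_algebra (G Mod N))))
        (open_normal G T))
      (carrier (completed_group_algebra G T))"

text \<open>The canonical map \<open>k[[H]] \<rightarrow> k[[G]]\<close> for a closed subgroup \<open>H\<close>, induced by the
  maps \<open>H/(H \<inter> N) \<rightarrow> G/N\<close>.\<close>

definition completed_inclusion ::
    "('g, 'm) monoid_scheme \<Rightarrow> 'g topology \<Rightarrow> 'g set \<Rightarrow>
      ('g set \<Rightarrow> 'g set \<Rightarrow> 'k::comm_ring_1) \<Rightarrow> 'g set \<Rightarrow> 'g set \<Rightarrow> 'k" where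
  "completed_inclusion G T H x =
    (\<lambda>N \<in> open_normal G T. group_algebra_map (\<lambda>D. N <#>\<^bsub>G\<^esub> D) (x (H \<inter> N)))"


section \<open>Profinite modules\<close>

record ('r, 'm) top_module = "('r, 'm) module" +
  mtop :: "'m topology"

text \<open>The library locale \<open>module\<close> covers commutative rings only.\<close>

locale left_module = R?: ring R + M?: abelian_group M
  for R :: "('r, 'a) ring_scheme" (structure) and M :: "('r, 'm, 'b) module_scheme" (structure) +
  assumes smult_closed:
      "\<lbrakk>a \<in> carrier R; x \<in> carrier M\<rbrakk> \<Longrightarrow> a \<odot>\<^bsub>M\<^esub> x \<in> carrier M"
    and smult_l_distr:
      "\<lbrakk>a \<in> carrier R; b \<in> carrier R; x \<in> carrier M\<rbrakk> \<Longrightarrow>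
        (a \<oplus>\<^bsub>R\<^esub> b) \<odot>\<^bsub>M\<^esub> x = a \<odot>\<^bsub>M\<^esub> x \<oplus>\<^bsub>M\<^esub> b \<odot>\<^bsub>M\<^esub> x"
    and smult_r_distr:
      "\<lbrakk>a \<in> carrier R; x \<in> carrier M; y \<in> carrier M\<rbrakk> \<Longrightarrow>
        a \<odot>\<^bsub>M\<^esub> (x \<oplus>\<^bsub>M\<^esub> y) = a \<odot>\<^bsub>M\<^esub> x \<oplus>\<^bsub>M\<^esub> a \<odot>\<^bsub>M\<^esub> y"
    and smult_assoc:
      "\<lbrakk>a \<in> carrier R; b \<in> carrier R; x \<in> carrier M\<rbrakk> \<Longrightarrow>
        (a \<otimes>\<^bsub>R\<^esub> b) \<odot>\<^bsub>M\<^esub> x = a \<odot>\<^bsub>M\<^esub> (b \<odot>\<^bsub>M\<^esub> x)"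
    and smult_one:
      "x \<in> carrier M \<Longrightarrow> \<one>\<^bsub>R\<^esub> \<odot>\<^bsub>M\<^esub> x = x"

locale profinite_module = left_module R M
  for R :: "('r, 'a) ring_scheme" (structure) and RT :: "'r topology"
    and M :: "('r, 'm, 'b) top_module_scheme" (structure) +
  assumes profinite_add: "profinite_group (add_monoid M) (mtop M)"
    and continuous_smult:
      "continuous_map (prod_topology RT (mtop M)) (mtop M) (\<lambda>(a, x). a \<odot>\<^bsub>M\<^esub> x)"

abbreviation profinite_cga_module ::
    "('g, 'n) monoid_scheme \<Rightarrow> 'g topology \<Rightarrow>
      ('g set \<Rightarrow> 'g set \<Rightarrow> 'k::comm_ring_1, 'm) top_module \<Rightarrow> bool" where
  "profinite_cga_module G T M \<equiv>
    profinite_module (completed_group_algebra G T) (completed_group_algebra_topology G T) M"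

definition closed_submodule ::
    "('r, 'a) ring_scheme \<Rightarrow> ('r, 'm) top_module \<Rightarrow> 'm set \<Rightarrow> bool" where
  "closed_submodule R M S \<longleftrightarrow>
    subgroup S (add_monoid M) \<and> closedin (mtop M) S \<and>
    (\<forall>a \<in> carrier R. \<forall>x \<in> S. a \<odot>\<^bsub>M\<^esub> x \<in> S)"

text \<open>Finite generation of profinite modules is topological: the smallest closed submodule
  containing the generators is the whole module.\<close>

definition finitely_generated_profinite ::
    "('r, 'a) ring_scheme \<Rightarrow> ('r, 'm) top_module \<Rightarrow> bool" where
  "finitely_generated_profinite R M \<longleftrightarrow>
    (\<exists>X. finite X \<and> X \<subseteq> carrier M \<and> \<Inter>{S. closed_submodule R M S \<and> X \<subseteq> S} = carrier M)"

definition continuous_hom ::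
    "('r, 'a) ring_scheme \<Rightarrow> ('r, 'm) top_module \<Rightarrow> ('r, 'n) top_module \<Rightarrow> ('m \<Rightarrow> 'n) set" where
  "continuous_hom R M N =
    {f \<in> hom (add_monoid M) (add_monoid N). continuous_map (mtop M) (mtop N) f \<and>
      (\<forall>a \<in> carrier R. \<forall>x \<in> carrier M. f (a \<odot>\<^bsub>M\<^esub> x) = a \<odot>\<^bsub>N\<^esub> f x)}"

definition restrict_scalars ::
    "('s \<Rightarrow> 'r) \<Rightarrow> ('r, 'm) top_module \<Rightarrow> ('s, 'm) top_module" where
  "restrict_scalars i M =
    \<lparr>carrier = carrier M, monoid.mult = monoid.mult M, monoid.one = monoid.one M,
     ring.zero = ring.zero M, ring.add = ring.add M,
     smult = (\<lambda>a x. i a \<odot>\<^bsub>M\<^esub> x), mtop = mtop M\<rparr>"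


section \<open>Relative projectivity\<close>

text \<open>A formula of HOL cannot quantify over types, so the element types of the test modules \<open>V\<close> and
  \<open>W\<close> are parameters; they are independent of \<open>U\<close> and of each other,
  and a theorem that leaves them as type variables covers test modules of every type.\<close>

definition relatively_projective ::
    "'v itself \<Rightarrow> 'w itself \<Rightarrow> ('g, 'n) monoid_scheme \<Rightarrow> 'g topology \<Rightarrow> 'g set \<Rightarrow>
      ('g set \<Rightarrow> 'g set \<Rightarrow> 'k::comm_ring_1, 'u) top_module \<Rightarrow> bool" where
  "relatively_projective _ _ G T H U \<longleftrightarrow>
    (\<forall>(V :: ('g set \<Rightarrow> 'g set \<Rightarrow> 'k, 'v) top_module) (W :: ('g set \<Rightarrow> 'g set \<Rightarrow> 'k, 'w) top_module) \<beta> \<phi>.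
      profinite_cga_module G T V \<longrightarrow>
      profinite_cga_module G T W \<longrightarrow>
      \<beta> \<in> continuous_hom (completed_group_algebra G T) V W \<longrightarrow>
      \<beta> ` carrier V = carrier W \<longrightarrow>
      \<phi> \<in> continuous_hom (completed_group_algebra G T) U W \<longrightarrow>
      (\<exists>\<rho> \<in> continuous_hom (completed_group_algebra (G\<lparr>carrier := H\<rparr>) (subtopology T H))
               (restrict_scalars (completed_inclusion G T H) U)
               (restrict_scalars (completed_inclusion G T H) V).
         \<forall>u \<in> carrier U. \<beta> (\<rho> u) = \<phi> u) \<longrightarrow>
      (\<exists>\<rho> \<in> continuous_hom (completed_group_algebra G T) U V.
         \<forall>u \<in> carrier U. \<beta> (\<rho> u) = \<phi> u))"

end

theory Submission
  imports Defs "HOL-Algebra.Zassenhaus"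
begin

text \<open>
  If \<open>U\<close> is relatively \<open>H\<close>-projective, it is relatively \<open>K\<close>-projective for every subgroup \<open>K\<close>
  containing \<open>H\<close>, because \<open>k[[K]]\<close>-homomorphisms restrict to \<open>k[[H]]\<close>-homomorphisms.  For the converse, let
  \<open>\<rho>\<close> be a \<open>k[[H]]\<close>-lift of \<open>\<phi>\<close> along \<open>\<beta> : V \<rightarrow> W\<close> and let \<open>S\<close> be an open submodule of \<open>V\<close>.  Modulo \<open>S\<close>
  the map \<open>\<rho>\<close> factors through a finite quotient of \<open>U\<close>, so all scalars involved act through \<open>k[G/N]\<close> for
  some open normal \<open>N\<close>.  As \<open>H\<close> and \<open>HN\<close> have the same image in \<open>G/N\<close>, the reduction of \<open>\<rho>\<close> is
  \<open>k[[HN]]\<close>-linear, and \<open>HN\<close>-projectivity gives a \<open>k[[G]]\<close>-lift \<open>U \<rightarrow> V/S\<close> of \<open>\<phi>\<close> modulo \<open>\<beta>(S)\<close>.  Finite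
  generation of \<open>U\<close> makes the set of lifts modulo \<open>S\<close> closed in the compact space of all maps \<open>U \<rightarrow> V\<close>,
  so the lifts modulo all the \<open>S\<close> have a common element, which is the required lift.
\<close>

section \<open>Profinite groups\<close>

text \<open>The tube lemma: the complement is the image of a closed set under projection along a
  compact factor, and such projections are closed. It shows that conditions quantified over a
  compact set are open in \<open>open_subgroup_base\<close>, \<open>open_submodule_base_zero\<close>
  and \<open>smult_factors_open_normal\<close>.\<close>

lemma openin_Collect_Ball_compact:
  assumes "compact_space X" "closedin X C" "openin (prod_topology X Y) O'"
  shows "openin Y {y \<in> topspace Y. \<forall>x\<in>C. (x, y) \<in> O'}"
proof -
  let ?F = "(C \<times> topspace Y) - O'"
  have "closedin (prod_topology X Y) ?F"
    using assms by (intro closedin_diff) (auto simp: closedin_prod_Times_iff)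
  then have "closedin Y (snd ` ?F)"
    using closed_map_snd[OF assms(1)] by (auto simp: closed_map_def)
  moreover have "{y \<in> topspace Y. \<forall>x\<in>C. (x, y) \<in> O'} = topspace Y - snd ` ?F"
    by force
  ultimately show ?thesis by auto
qed

lemma product_topology_nhds:
  assumes "openin (product_topology X I) S" "x \<in> S"
  obtains U where "finite {i \<in> I. U i \<noteq> topspace (X i)}" "x \<in> Pi\<^sub>E I U" "Pi\<^sub>E I U \<subseteq> S"
proof -
  from bspec[OF assms(1)[unfolded openin_product_topology_alt] assms(2)] show ?thesis
  proof (elim exE conjE)
    fix U assume "finite {i \<in> I. U i \<noteq> topspace (X i)}" "x \<in> Pi\<^sub>E I U" "Pi\<^sub>E I U \<subseteq> S"
    then show ?thesis by (rule that)
  qed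
qed

text \<open>Fibres suffice because every subset of the discrete codomain is a union of points. Maps
  reduced modulo an open submodule are handled in this form.\<close>

lemma continuous_map_discrete_iff:
  "continuous_map X (discrete_topology D) f \<longleftrightarrow>
    f \<in> topspace X \<rightarrow> D \<and> (\<forall>x \<in> topspace X. openin X {y \<in> topspace X. f y = f x})"
proof
  assume f: "continuous_map X (discrete_topology D) f"
  then have "f \<in> topspace X \<rightarrow> D" by (auto simp: continuous_map_def)
  moreover have "openin X {y \<in> topspace X. f y = f x}" if "x \<in> topspace X" for x
    using openin_continuous_map_preimage[OF f, of "{f x}"] f that
    by (auto simp: continuous_map_def)
  ultimately show "f \<in> topspace X \<rightarrow> D \<and> (\<forall>x \<in> topspace X. openin X {y \<in> topspace X. f y = f x})"
    by blast
next
  assume f: "f \<in> topspace X \<rightarrow> D \<and> (\<forall>x \<in> topspace X. openin X {y \<in> topspace X. f y = f x})"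
  have "openin X {y \<in> topspace X. f y \<in> S}" if "S \<subseteq> D" for S
  proof -
    have "{y \<in> topspace X. f y \<in> S} =
        \<Union>((\<lambda>x. {y \<in> topspace X. f y = f x}) ` {y \<in> topspace X. f y \<in> S})"
      by auto
    also have "openin X \<dots>" using f by (intro openin_Union) blast
    finally show ?thesis .
  qed
  then show "continuous_map X (discrete_topology D) f"
    using f by (auto simp: continuous_map_def)
qed

context profinite_group
begin

text \<open>In a compact Hausdorff space components and quasi-components coincide, so the
  quasi-component of \<open>x\<close> is \<open>{x}\<close>. Compactness of the complement of
  \<open>O'\<close> then provides one clopen set separating it from \<open>x\<close>.\<close>

lemma clopen_base:
  assumes "openin T O'" "x \<in> O'"
  obtains C where "closedin T C" "openin T C" "x \<in> C" "C \<subseteq> O'"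
proof -
  have x: "x \<in> topspace T" using assms openin_subset by blast
  have "connected_component_of_set T x \<subseteq> {x}"
    using totally_disconnected[OF connectedin_connected_component_of[of T x]]
      connected_component_of_refl[of T x] x by auto
  then have "quasi_component_of_set T x \<subseteq> {x}"
    using quasi_eq_connected_component_of[of T x] compact Hausdorff by auto
  then have q: "quasi_component_of_set T x = {x}"
    using x by auto
  have "compactin T (topspace T - O')"
    using compact assms by (intro closedin_compact_space) auto
  moreover have "{x} \<in> quasi_components_of T"
    unfolding quasi_components_of_def by (rule image_eqI[where x = x]) (simp_all add: q x)
  moreover have "disjnt {x} (topspace T - O')" using assms by auto
  ultimately have "separated_between T {x} (topspace T - O')"
    using separated_between_quasi_component_compact by blast
  then obtain C where "closedin T C" "openin T C" "{x} \<subseteq> C" "topspace T - O' \<subseteq> topspace T - C"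
    by (auto simp: separated_between)
  moreover then have "C \<subseteq> O'" using openin_subset[of T C] by auto
  ultimately show ?thesis using that by auto
qed

lemma continuous_translation:
  assumes "g \<in> carrier G"
  shows "continuous_map T T (\<lambda>x. x \<otimes> g)"
proof -
  have "continuous_map T (prod_topology T T) (\<lambda>x. (x, g))"
    using assms topspace_eq by (auto simp: continuous_map_pairwise o_def)
  from continuous_map_compose[OF this continuous_mult] show ?thesis by (simp add: o_def)
qed

text \<open>The stabiliser of a clopen neighbourhood \<open>C\<close> of the identity under right
  translation is a subgroup; it is open by the tube lemma, as \<open>C\<close> is compact and open,
  and it lies in \<open>C\<close> because \<open>C\<close> contains the identity.\<close>

lemma open_subgroup_base:
  assumes "openin T O'" "\<one> \<in> O'"
  obtains S where "subgroup S G" "openin T S" "S \<subseteq> O'"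
proof -
  obtain C where C: "closedin T C" "openin T C" "\<one> \<in> C" "C \<subseteq> O'"
    using clopen_base assms by metis
  have CG: "C \<subseteq> carrier G" using C openin_subset topspace_eq by blast
  let ?P = "{z \<in> topspace (prod_topology T T). (case z of (x, y) \<Rightarrow> x \<otimes> y) \<in> C}"
  have 1: "openin (prod_topology T T) ?P"
    using openin_continuous_map_preimage[OF continuous_mult C(2)] .
  have "continuous_map (prod_topology T T) (prod_topology T T) (\<lambda>z. (fst z, inv (snd z)))"
    using continuous_map_compose[OF continuous_map_snd continuous_inv]
    by (auto simp: continuous_map_pairwise o_def intro: continuous_map_fst)
  from continuous_map_compose[OF this continuous_mult]
  have c: "continuous_map (prod_topology T T) T (\<lambda>z. fst z \<otimes> inv (snd z))"
    by (simp add: o_def)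
  let ?Q = "{z \<in> topspace (prod_topology T T). fst z \<otimes> inv (snd z) \<in> C}"
  have 2: "openin (prod_topology T T) ?Q"
    using openin_continuous_map_preimage[OF c C(2)] .
  \<comment> \<open>Imposing the condition on both \<open>g\<close> and its inverse amounts to
    \<open>C g = C\<close>, which makes \<open>S\<close> closed under inverses.\<close>
  define S where "S = {g \<in> carrier G. \<forall>x\<in>C. x \<otimes> g \<in> C \<and> x \<otimes> inv g \<in> C}"
  have "S = {y \<in> topspace T. \<forall>x\<in>C. (x, y) \<in> ?P} \<inter> {y \<in> topspace T. \<forall>x\<in>C. (x, y) \<in> ?Q}"
    using CG topspace_eq by (auto simp: S_def)
  then have "openin T S"
    using openin_Collect_Ball_compact[OF compact C(1) 1] openin_Collect_Ball_compact[OF compact C(1) 2]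
    by auto
  moreover have "subgroup S G"
  proof (rule subgroupI)
    show "S \<subseteq> carrier G" by (auto simp: S_def)
    show "S \<noteq> {}" using CG by (auto simp: S_def intro!: exI[of _ \<one>])
    show "inv a \<in> S" if "a \<in> S" for a using that by (auto simp: S_def)
    show "a \<otimes> b \<in> S" if "a \<in> S" "b \<in> S" for a b
    proof -
      have "x \<otimes> (a \<otimes> b) = (x \<otimes> a) \<otimes> b" "x \<otimes> inv (a \<otimes> b) = (x \<otimes> inv b) \<otimes> inv a"
        if "x \<in> C" for x
        using that CG \<open>a \<in> S\<close> \<open>b \<in> S\<close> by (auto simp: S_def m_assoc inv_mult_group)
      then show ?thesis using that by (auto simp: S_def)
    qed
  qed
  moreover have "S \<subseteq> O'"
  proof
    fix g assume g: "g \<in> S"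
    then have "\<one> \<otimes> g \<in> C" using C by (auto simp: S_def)
    then show "g \<in> O'" using g C by (auto simp: S_def)
  qed
  ultimately show ?thesis using that by blast
qed

lemma openin_rcoset:
  assumes "openin T S" "x \<in> carrier G"
  shows "openin T (S #> x)"
proof -
  have "S \<subseteq> carrier G" using assms openin_subset topspace_eq by blast
  moreover have "y = y \<otimes> inv x \<otimes> x" if "y \<in> carrier G" for y
    using that assms by (simp add: m_assoc)
  ultimately have "S #> x = {y \<in> topspace T. y \<otimes> inv x \<in> S}"
    using assms topspace_eq by (fastforce simp: r_coset_def m_assoc)
  then show ?thesis
    using openin_continuous_map_preimage[OF continuous_translation assms(1), of "inv x"] assms by auto
qed

text \<open>The cosets form an open cover of a compact space. As they are nonempty and pairwise
  disjoint, a finite subcover must already contain all of them.\<close>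

lemma finite_rcosets:
  assumes "openin T S" "subgroup S G"
  shows "finite (rcosets S)"
proof -
  have "\<forall>C\<in>rcosets S. openin T C"
    using assms openin_rcoset by (auto simp: RCOSETS_def)
  moreover have cov: "\<Union>(rcosets S) = topspace T"
    using assms(2) topspace_eq rcosets_part_G by auto
  ultimately obtain F where F: "finite F" "F \<subseteq> rcosets S" "\<Union>F = topspace T"
    using compact unfolding compact_space_alt
    by (metis Sup_subset_mono order_antisym order_refl)
  have "rcosets S \<subseteq> F"
  proof
    fix C assume C: "C \<in> rcosets S"
    then obtain y where "y \<in> C" using assms(2) subgroup.rcosets_non_empty by blast
    then obtain D where "D \<in> F" "y \<in> D" using F cov C by blast
    then have "C = D"
      using rcos_disjoint[OF assms(2)] C F \<open>y \<in> C\<close> unfolding pairwise_def disjnt_def by blast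
    then show "C \<in> F" using \<open>D \<in> F\<close> by simp
  qed
  then show ?thesis using F(1) by (rule finite_subset)
qed

end


section \<open>Completed group algebras\<close>

lemma group_algebra_map_eq_sum:
  assumes "finite A" "{x. f x \<noteq> 0} \<subseteq> A"
  shows "group_algebra_map h f y = (\<Sum>x\<in>A. if h x = y then f x else 0)"
proof -
  have "(\<Sum>x\<in>A. if h x = y then f x else 0) = (\<Sum>x\<in>{x\<in>A. h x = y}. f x)"
    using assms(1) by (simp add: sum.inter_filter)
  also have "\<dots> = group_algebra_map h f y"
    unfolding group_algebra_map_def using assms by (intro sum.mono_neutral_right) auto
  finally show ?thesis by simp
qed

lemma group_algebra_map_support: "{y. group_algebra_map h f y \<noteq> 0} \<subseteq> h ` {x. f x \<noteq> 0}"
proof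
  fix y assume "y \<in> {y. group_algebra_map h f y \<noteq> 0}"
  then have "(\<Sum>x | f x \<noteq> 0 \<and> h x = y. f x) \<noteq> 0" by (simp add: group_algebra_map_def)
  then obtain x where "f x \<noteq> 0" "h x = y"
    by (metis (mono_tags, lifting) mem_Collect_eq sum.neutral)
  then show "y \<in> h ` {x. f x \<noteq> 0}" by auto
qed

text \<open>Both sums are written over finite sets that do not depend on the fibre, so they can be
  interchanged; the sum over \<open>y\<close> then collapses to the single term
  \<open>y = g x\<close>.\<close>

lemma group_algebra_map_compose:
  fixes f :: "'a \<Rightarrow> 'k::comm_ring_1"
  assumes "finite {x. f x \<noteq> 0}"
  shows "group_algebra_map h (group_algebra_map g f) = group_algebra_map (\<lambda>x. h (g x)) f"
proof
  fix z
  let ?A = "{x. f x \<noteq> 0}"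
  have "group_algebra_map h (group_algebra_map g f) z =
      (\<Sum>y\<in>g ` ?A. if h y = z then group_algebra_map g f y else 0)"
    using assms by (intro group_algebra_map_eq_sum group_algebra_map_support) auto
  also have "\<dots> = (\<Sum>y\<in>g ` ?A. \<Sum>x\<in>?A. if g x = y then (if h (g x) = z then f x else 0) else 0)"
  proof (rule sum.cong[OF refl])
    fix y
    show "(if h y = z then group_algebra_map g f y else 0) =
        (\<Sum>x\<in>?A. if g x = y then (if h (g x) = z then f x else 0) else 0)"
      unfolding group_algebra_map_eq_sum[OF assms order_refl]
      by (cases "h y = z") (auto intro!: sum.cong sum.neutral)
  qed
  also have "\<dots> = (\<Sum>x\<in>?A. \<Sum>y\<in>g ` ?A. if g x = y then (if h (g x) = z then f x else 0) else 0)"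
    by (rule sum.swap)
  also have "\<dots> = (\<Sum>x\<in>?A. if h (g x) = z then f x else 0)"
    using assms by (intro sum.cong) (auto simp: sum.delta)
  also have "\<dots> = group_algebra_map (\<lambda>x. h (g x)) f z"
    using group_algebra_map_eq_sum[OF assms order_refl] by metis
  finally show "group_algebra_map h (group_algebra_map g f) z = group_algebra_map (\<lambda>x. h (g x)) f z" .
qed

lemma group_algebra_map_cong:
  assumes "\<And>x. f x \<noteq> 0 \<Longrightarrow> h x = h' x"
  shows "group_algebra_map h f = group_algebra_map h' f"
  unfolding group_algebra_map_def using assms by (intro ext sum.cong) auto

lemma carrier_group_algebra:
  "f \<in> carrier (group_algebra Q) \<longleftrightarrow> finite {x. f x \<noteq> 0} \<and> {x. f x \<noteq> 0} \<subseteq> carrier Q"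
  by (simp add: group_algebra_def)

lemma group_algebra_map_closed:
  assumes "finite {x. f x \<noteq> 0}" "\<And>x. f x \<noteq> 0 \<Longrightarrow> h x \<in> carrier Q"
  shows "group_algebra_map h f \<in> carrier (group_algebra Q)"
  using assms group_algebra_map_support[of h f] unfolding carrier_group_algebra
  by (auto intro: finite_subset)

text \<open>Cosets depend on the multiplication alone, so cosets formed in a subgroup are literally
  cosets formed in \<open>G\<close>.\<close>

lemma r_coset_carrier_update [simp]: "r_coset (G\<lparr>carrier := K\<rparr>) = r_coset G"
  by (simp add: fun_eq_iff r_coset_def)

lemma set_mult_carrier_update [simp]: "set_mult (G\<lparr>carrier := K\<rparr>) = set_mult G"
  by (simp add: fun_eq_iff set_mult_def)

lemma carrier_cga:
  "x \<in> carrier (completed_group_algebra G T) \<longleftrightarrow>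
    x \<in> extensional (open_normal G T) \<and>
    (\<forall>N \<in> open_normal G T. finite {C. x N C \<noteq> 0} \<and> {C. x N C \<noteq> 0} \<subseteq> (\<lambda>g. N #>\<^bsub>G\<^esub> g) ` carrier G) \<and>
    (\<forall>M \<in> open_normal G T. \<forall>N \<in> open_normal G T. M \<subseteq> N \<longrightarrow>
       group_algebra_map (\<lambda>C. N <#>\<^bsub>G\<^esub> C) (x M) = x N)"
  unfolding carrier_FactGroup[symmetric] carrier_group_algebra[symmetric]
  by (simp add: completed_group_algebra_def PiE_def Pi_iff conj_ac)

text \<open>Evaluates the projection \<open>G/M \<rightarrow> G/N\<close> on a coset; the reason is
  \<open>N M = N\<close>.\<close>

lemma (in group) set_mult_rcos:
  assumes "subgroup N G" "subgroup M G" "M \<subseteq> N" "x \<in> carrier G"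
  shows "N <#> (M #> x) = N #> x"
proof -
  have "N <#> M = N"
  proof
    show "N <#> M \<subseteq> N"
      using assms subgroup.m_closed[OF assms(1)] by (auto simp: set_mult_def)
    show "N \<subseteq> N <#> M"
    proof
      fix n assume "n \<in> N"
      then have "n \<otimes> \<one> = n" using subgroup.mem_carrier[OF assms(1)] by simp
      then show "n \<in> N <#> M"
        using \<open>n \<in> N\<close> subgroup.one_closed[OF assms(2)] unfolding set_mult_def by force
    qed
  qed
  then show ?thesis
    using setmult_rcos_assoc[of N M x] assms by (simp add: subgroup.subset)
qed

section \<open>Subgroups and the canonical maps \<open>k[[H]] \<rightarrow> k[[G]]\<close>\<close>

lemma (in group) open_normal_Int_subgroup:
  assumes "subgroup H G" "N \<in> open_normal G T"
  shows "H \<inter> N \<in> open_normal (G\<lparr>carrier := H\<rparr>) (subtopology T H)"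
  using assms normal_Int_subgroup[of H N]
  by (auto simp: open_normal_def openin_subtopology Int_commute)

lemma open_normal_subgroup: "N \<in> open_normal G T \<Longrightarrow> subgroup N G"
  by (auto simp: open_normal_def normal_imp_subgroup)

lemma (in group) subgroup_of_open_normal:
  assumes "subgroup H G" "N \<in> open_normal (G\<lparr>carrier := H\<rparr>) T"
  shows "subgroup N G" "N \<subseteq> H"
  using assms open_normal_subgroup[OF assms(2)] incl_subgroup subgroup.subset by fastforce+

text \<open>For \<open>M \<subseteq> N\<close> there are two routes from
  \<open>H/(H \<inter> M)\<close> to \<open>G/N\<close>, through \<open>G/M\<close> and through
  \<open>H/(H \<inter> N)\<close>. They agree on cosets, so the image family is again
  compatible.\<close>

lemma (in group) completed_inclusion_closed:
  fixes a :: "'a set \<Rightarrow> 'a set \<Rightarrow> 'k::comm_ring_1"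
  assumes H: "subgroup H G"
    and a: "a \<in> carrier (completed_group_algebra (G\<lparr>carrier := H\<rparr>) (subtopology T H))"
  shows "completed_inclusion G T H a \<in> carrier (completed_group_algebra G T)"
proof -
  note a' = a[unfolded carrier_cga, simplified]
  have HN: "H \<inter> N \<in> open_normal (G\<lparr>carrier := H\<rparr>) (subtopology T H)" if "N \<in> open_normal G T" for N
    using open_normal_Int_subgroup[OF H that] .
  have sup: "\<exists>g\<in>H. C = (H \<inter> N) #> g" if "N \<in> open_normal G T" "a (H \<inter> N) C \<noteq> 0" for N C
    using a' HN[OF that(1)] that(2) by blast
  have fin: "finite {C. a (H \<inter> N) C \<noteq> 0}" if "N \<in> open_normal G T" for N
    using a' HN[OF that(1)] by blast
  have HG: "H \<subseteq> carrier G" using H subgroup.subset by blast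
  have sub: "subgroup (H \<inter> N) G" if "N \<in> open_normal G T" for N
    using subgroup_of_open_normal(1)[OF H HN[OF that]] .
  have 1: "completed_inclusion G T H a N \<in> carrier (group_algebra (G Mod N))"
    if N: "N \<in> open_normal G T" for N
  proof -
    have "N <#> C \<in> carrier (G Mod N)" if C: "a (H \<inter> N) C \<noteq> 0" for C
    proof -
      obtain g where g: "g \<in> H" "C = (H \<inter> N) #> g" using sup[OF N C] by blast
      then have "N <#> C = N #> g"
        using HG sub[OF N] open_normal_subgroup[OF N] by (simp add: set_mult_rcos subset_iff)
      then show ?thesis using g HG by (auto simp: carrier_FactGroup)
    qed
    then show ?thesis
      using N fin[OF N] by (auto simp: completed_inclusion_def intro!: group_algebra_map_closed)
  qed
  have 2: "group_algebra_map (\<lambda>C. N <#> C) (completed_inclusion G T H a M) = completed_inclusion G T H a N"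
    if M: "M \<in> open_normal G T" and N: "N \<in> open_normal G T" and "M \<subseteq> N" for M N
  proof -
    have eq: "N <#> (M <#> C) = N <#> ((H \<inter> N) <#> C)" if C: "a (H \<inter> M) C \<noteq> 0" for C
    proof -
      obtain g where g: "g \<in> H" "C = (H \<inter> M) #> g" using sup[OF M C] by blast
      moreover have "H \<inter> M \<subseteq> H \<inter> N" using \<open>M \<subseteq> N\<close> by auto
      moreover have "g \<in> carrier G" using g HG by blast
      ultimately show ?thesis
        using sub[OF M] sub[OF N] open_normal_subgroup[OF M] open_normal_subgroup[OF N] \<open>M \<subseteq> N\<close>
        by (simp add: set_mult_rcos)
    qed
    have "group_algebra_map (\<lambda>C. N <#> C) (completed_inclusion G T H a M) =
        group_algebra_map (\<lambda>C. N <#> (M <#> C)) (a (H \<inter> M))"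
      using M fin[OF M] by (simp add: completed_inclusion_def group_algebra_map_compose)
    also have "\<dots> = group_algebra_map (\<lambda>C. N <#> ((H \<inter> N) <#> C)) (a (H \<inter> M))"
      using eq by (rule group_algebra_map_cong)
    also have "\<dots> = group_algebra_map (\<lambda>C. N <#> C) (group_algebra_map (\<lambda>C. (H \<inter> N) <#> C) (a (H \<inter> M)))"
      using fin[OF M] by (simp add: group_algebra_map_compose)
    also have "group_algebra_map (\<lambda>C. (H \<inter> N) <#> C) (a (H \<inter> M)) = a (H \<inter> N)"
      using a' HN[OF M] HN[OF N] \<open>M \<subseteq> N\<close> by (metis Int_mono order_refl)
    finally show ?thesis using N by (simp add: completed_inclusion_def)
  qed
  show ?thesis
    unfolding carrier_cga using 1 2
    by (auto simp: completed_inclusion_def carrier_group_algebra carrier_FactGroup)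
qed

text \<open>Since \<open>H \<inter> (K \<inter> N) = H \<inter> N\<close>, the component at
  \<open>N\<close> is induced on either side by \<open>H/(H \<inter> N) \<rightarrow> G/N\<close>.
  This is what allows \<open>k[[K]]\<close>-linearity to be restricted to
  \<open>k[[H]]\<close>.\<close>

lemma (in group) completed_inclusion_trans:
  fixes a :: "'a set \<Rightarrow> 'a set \<Rightarrow> 'k::comm_ring_1"
  assumes H: "subgroup H G" and K: "subgroup K G" and "H \<subseteq> K"
    and a: "a \<in> carrier (completed_group_algebra (G\<lparr>carrier := H\<rparr>) (subtopology T H))"
  shows "completed_inclusion G T K (completed_inclusion (G\<lparr>carrier := K\<rparr>) (subtopology T K) H a) =
    completed_inclusion G T H a"
proof
  fix N
  show "completed_inclusion G T K (completed_inclusion (G\<lparr>carrier := K\<rparr>) (subtopology T K) H a) N =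
    completed_inclusion G T H a N"
  proof (cases "N \<in> open_normal G T")
    case N: True
    note a' = a[unfolded carrier_cga, simplified]
    have HN: "H \<inter> N \<in> open_normal (G\<lparr>carrier := H\<rparr>) (subtopology T H)"
      and KN: "K \<inter> N \<in> open_normal (G\<lparr>carrier := K\<rparr>) (subtopology T K)"
      using open_normal_Int_subgroup N H K by blast+
    have fin: "finite {C. a (H \<inter> N) C \<noteq> 0}" using a' HN by blast
    have HK: "H \<inter> (K \<inter> N) = H \<inter> N" using \<open>H \<subseteq> K\<close> by auto
    have "N <#> ((K \<inter> N) <#> C) = N <#> C" if C: "a (H \<inter> N) C \<noteq> 0" for C
    proof -
      obtain g where g: "g \<in> H" "C = (H \<inter> N) #> g" using a' HN C by blast
      moreover have "H \<inter> N \<subseteq> K \<inter> N" using \<open>H \<subseteq> K\<close> by auto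
      moreover have "g \<in> carrier G" using H g subgroup.mem_carrier by metis
      ultimately show ?thesis
        using subgroup_of_open_normal(1)[OF H HN] subgroup_of_open_normal(1)[OF K KN]
          open_normal_subgroup[OF N]
        by (simp add: set_mult_rcos)
    qed
    then have "group_algebra_map (\<lambda>C. N <#> ((K \<inter> N) <#> C)) (a (H \<inter> N)) =
        group_algebra_map (\<lambda>C. N <#> C) (a (H \<inter> N))"
      by (rule group_algebra_map_cong)
    then show ?thesis
      using N KN fin by (simp add: completed_inclusion_def HK group_algebra_map_compose)
  qed (simp add: completed_inclusion_def)
qed

text \<open>\<open>H\<close> and \<open>H N\<close> have the same image in \<open>G/N\<close>, so at
  level \<open>N\<close> no more scalars come from \<open>k[[H N]]\<close> than from
  \<open>k[[H]]\<close>. The finitely many coefficients of \<open>b\<close> at \<open>N\<close> are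
  carried to representatives in \<open>H\<close>.\<close>

lemma (in group) completed_inclusion_approx:
  fixes b :: "'a set \<Rightarrow> 'a set \<Rightarrow> 'k::comm_ring_1"
  assumes H: "subgroup H G" and N: "N \<in> open_normal G T"
    and b: "b \<in> carrier (completed_group_algebra (G\<lparr>carrier := H <#> N\<rparr>) (subtopology T (H <#> N)))"
  obtains a where "a \<in> carrier (completed_group_algebra (G\<lparr>carrier := H\<rparr>) (subtopology T H))"
    "completed_inclusion G T H a N = completed_inclusion G T (H <#> N) b N"
proof -
  have NG: "N \<lhd> G" using N by (simp add: open_normal_def)
  have sN: "subgroup N G" using N open_normal_subgroup by blast
  have HG: "H \<subseteq> carrier G" using H subgroup.subset by blast
  have K: "subgroup (H <#> N) G"
    using mult_norm_subgroup[OF NG H] commut_normal[OF H NG] by simp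
  \<comment> \<open>Hence the component of \<open>k[[H N]]\<close> from which
    \<open>completed_inclusion\<close> computes level \<open>N\<close> is the one at
    \<open>N\<close> itself.\<close>
  have NK: "(H <#> N) \<inter> N = N"
  proof -
    have "n \<in> H <#> N" if "n \<in> N" for n
    proof -
      have "\<one> \<otimes> n = n" using subgroup.mem_carrier[OF sN that] by simp
      then show ?thesis using that subgroup.one_closed[OF H] unfolding set_mult_def by force
    qed
    then show ?thesis by blast
  qed
  have KN: "N \<in> open_normal (G\<lparr>carrier := H <#> N\<rparr>) (subtopology T (H <#> N))"
    using open_normal_Int_subgroup[OF K N] NK by simp
  note b' = b[unfolded carrier_cga, simplified]
  have fin: "finite {C. b N C \<noteq> 0}" using b' KN by blast
  \<comment> \<open>Normality gives \<open>H N = N H\<close>, and a factor from \<open>N\<close> on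
    the left is absorbed by the coset.\<close>
  have "\<exists>h\<in>H. C = N #> h" if C: "b N C \<noteq> 0" for C
  proof -
    obtain g where g: "g \<in> H <#> N" "C = N #> g" using b' KN C by blast
    then have "g \<in> N <#> H" using commut_normal[OF H NG] by simp
    then obtain n h where "n \<in> N" "h \<in> H" "g = n \<otimes> h" by (auto simp: set_mult_def)
    moreover have "N #> (n \<otimes> h) = N #> n #> h"
      using \<open>n \<in> N\<close> \<open>h \<in> H\<close> HG sN by (auto simp: coset_mult_assoc subgroup.subset subgroup.mem_carrier)
    ultimately show ?thesis using g sN subgroup.rcos_const[OF sN is_group] by auto
  qed
  then obtain s where s: "\<And>C. b N C \<noteq> 0 \<Longrightarrow> s C \<in> H \<and> C = N #> s C" by metis
  \<comment> \<open>\<open>c\<close> lifts the component \<open>b N\<close> to the abstract group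
    algebra of \<open>H\<close>, along the chosen representatives \<open>s\<close>. The element
    \<open>a\<close> below is the image of \<open>c\<close> in \<open>k[[H]]\<close>.\<close>
  define c where "c = group_algebra_map s (b N)"
  have csup: "{x. c x \<noteq> 0} \<subseteq> s ` {C. b N C \<noteq> 0}"
    unfolding c_def by (rule group_algebra_map_support)
  then have cfin: "finite {x. c x \<noteq> 0}" and cH: "\<And>x. c x \<noteq> 0 \<Longrightarrow> x \<in> H"
    using fin s by (auto intro: finite_subset)
  define a where "a = (\<lambda>M \<in> open_normal (G\<lparr>carrier := H\<rparr>) (subtopology T H).
    group_algebra_map (\<lambda>x. M #> x) c)"
  have aM: "group_algebra_map (\<lambda>x. M #> x) c \<in> carrier (group_algebra (G\<lparr>carrier := H\<rparr> Mod M))" for M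
    using cfin cH by (auto intro!: group_algebra_map_closed simp: carrier_FactGroup)
  have "a \<in> carrier (completed_group_algebra (G\<lparr>carrier := H\<rparr>) (subtopology T H))"
    unfolding carrier_cga
  proof (intro conjI ballI impI)
    fix M M' assume M: "M \<in> open_normal (G\<lparr>carrier := H\<rparr>) (subtopology T H)"
      "M' \<in> open_normal (G\<lparr>carrier := H\<rparr>) (subtopology T H)" "M \<subseteq> M'"
    have "group_algebra_map (\<lambda>x. M' <#> (M #> x)) c = group_algebra_map (\<lambda>x. M' #> x) c"
      using M HG cH subgroup_of_open_normal(1)[OF H]
      by (intro group_algebra_map_cong set_mult_rcos) auto
    then show "group_algebra_map (\<lambda>C. M' <#>\<^bsub>G\<lparr>carrier := H\<rparr>\<^esub> C) (a M) = a M'"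
      using M cfin by (simp add: a_def group_algebra_map_compose)
  qed (use aM in \<open>auto simp: a_def carrier_group_algebra carrier_FactGroup\<close>)
  moreover have "completed_inclusion G T H a N = completed_inclusion G T (H <#> N) b N"
  proof -
    have HN: "H \<inter> N \<in> open_normal (G\<lparr>carrier := H\<rparr>) (subtopology T H)"
      using open_normal_Int_subgroup[OF H N] .
    have "completed_inclusion G T H a N =
        group_algebra_map (\<lambda>C. N <#> ((H \<inter> N) #> s C)) (b N)"
      using N HN cfin fin unfolding c_def
      by (simp add: completed_inclusion_def a_def c_def group_algebra_map_compose)
    also have "\<dots> = group_algebra_map (\<lambda>C. N <#> C) (b N)"
    proof (rule group_algebra_map_cong)
      fix C assume "b N C \<noteq> 0"
      then have C: "s C \<in> carrier G" and C': "N #> s C = C" using s HG by auto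
      have "N <#> ((H \<inter> N) #> s C) = N #> s C"
        by (rule set_mult_rcos[OF sN subgroup_of_open_normal(1)[OF H HN] Int_lower2 C])
      moreover have "N <#> (N #> s C) = N #> s C"
        by (rule set_mult_rcos[OF sN sN order_refl C])
      ultimately show "N <#> ((H \<inter> N) #> s C) = N <#> C" unfolding C' by simp
    qed
    finally show ?thesis using N NK by (simp add: completed_inclusion_def)
  qed
  ultimately show ?thesis using that by blast
qed

section \<open>The inverse limit topology of \<open>k[[G]]\<close>\<close>

context profinite_group
begin

lemma carrier_open_normal: "carrier G \<in> open_normal G T"
  using topspace_eq openin_topspace[of T] by (simp add: open_normal_def normal_inv_iff subgroup_self)

lemma Inter_open_normal:
  assumes "finite F" "F \<subseteq> open_normal G T"
  obtains N where "N \<in> open_normal G T" "\<forall>M\<in>F. N \<subseteq> M"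
proof -
  from assms have "\<exists>N\<in>open_normal G T. \<forall>M\<in>F. N \<subseteq> M"
  proof induction
    case empty
    then show ?case using carrier_open_normal by auto
  next
    case (insert M F)
    then obtain N where "N\<in>open_normal G T" "\<forall>M\<in>F. N \<subseteq> M" by auto
    with insert have "M \<inter> N \<in> open_normal G T" "\<forall>M'\<in>insert M F. M \<inter> N \<subseteq> M'"
      by (auto simp: open_normal_def normal_subgroup_intersect)
    then show ?case by blast
  qed
  then show ?thesis using that by blast
qed

lemma finite_carrier_group_algebra:
  assumes "N \<in> open_normal G T"
  shows "finite (carrier (group_algebra (G Mod N)) :: ('g set \<Rightarrow> 'k::{comm_ring_1, finite}) set)"
proof -
  have "finite (carrier (G Mod N))"
    using assms finite_rcosets by (auto simp: open_normal_def FactGroup_def normal_imp_subgroup)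
  then have "finite {f. (\<forall>x. (x \<in> carrier (G Mod N) \<longrightarrow> f x \<in> (UNIV :: 'k set)) \<and> (x \<notin> carrier (G Mod N) \<longrightarrow> f x = 0))}"
    by (intro finite_set_of_finite_funs) auto
  then show ?thesis
    by (rule rev_finite_subset) (unfold carrier_group_algebra subset_iff, blast)
qed

lemma topspace_cga_topology:
  "topspace (completed_group_algebra_topology G T) = carrier (completed_group_algebra G T)"
  by (auto simp: completed_group_algebra_topology_def completed_group_algebra_def)

text \<open>For finite \<open>k\<close> every \<open>k[G/N]\<close> is a finite discrete space, so
  their product is compact. Each compatibility condition is the equaliser of two continuous maps to
  a Hausdorff space, so \<open>k[[G]]\<close> is closed in the product.\<close>

lemma compact_cga:
  "compact_space (completed_group_algebra_topology G T ::
    ('g set \<Rightarrow> 'g set \<Rightarrow> 'k::{comm_ring_1, finite}) topology)"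
proof -
  define P where "P = product_topology (\<lambda>N. discrete_topology
    (carrier (group_algebra (G Mod N)) :: ('g set \<Rightarrow> 'k) set)) (open_normal G T)"
  have P: "compact_space P"
    unfolding P_def compact_space_product_topology
    using finite_carrier_group_algebra by (auto simp: compact_space_discrete_topology)
  have top: "topspace P = (\<Pi>\<^sub>E N\<in>open_normal G T. carrier (group_algebra (G Mod N)))"
    by (simp add: P_def)
  let ?D = "{(M, N). M \<in> open_normal G T \<and> N \<in> open_normal G T \<and> M \<subseteq> N}"
  let ?E = "\<lambda>(M, N). {x \<in> topspace P. group_algebra_map (\<lambda>C. N <#> C) (x M) = x N}"
  have "closedin P (?E (M, N))" if "(M, N) \<in> ?D" for M N
  proof -
    have pr: "continuous_map P (discrete_topology (carrier (group_algebra (G Mod L)))) (\<lambda>x. x L)"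
      if "L \<in> open_normal G T" for L
      unfolding P_def by (rule continuous_map_product_projection[OF that])
    have "continuous_map P (discrete_topology UNIV) (\<lambda>x. group_algebra_map (\<lambda>C. N <#> C) (x M))"
      using continuous_map_compose[OF pr[of M], of "discrete_topology UNIV" "group_algebra_map (\<lambda>C. N <#> C)"] that
      by (auto simp: o_def)
    moreover have "continuous_map P (discrete_topology UNIV) (\<lambda>x. x N)"
      using continuous_map_compose[OF pr[of N], of "discrete_topology UNIV" id] that
      by (auto simp: o_def)
    ultimately show ?thesis
      using closedin_continuous_maps_eq[of "discrete_topology UNIV" P] Hausdorff_space_discrete_topology
      by auto
  qed
  \<comment> \<open>The whole space joins the family because \<open>closedin_Inter\<close> asks for
    a nonempty family.\<close>
  then have "closedin P (topspace P \<inter> \<Inter>(?E ` ?D))"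
    by (intro closedin_Inter[of "insert (topspace P) (?E ` ?D)", simplified]) auto
  moreover have "topspace P \<inter> \<Inter>(?E ` ?D) = carrier (completed_group_algebra G T)"
    unfolding top by (auto simp: completed_group_algebra_def)
  ultimately have "closedin P (carrier (completed_group_algebra G T))" by simp
  then have "compactin P (carrier (completed_group_algebra G T))"
    using P closedin_compact_space by blast
  then show ?thesis
    unfolding completed_group_algebra_topology_def P_def[symmetric]
    using compact_space_subtopology by blast
qed

text \<open>A basic neighbourhood in the product constrains only finitely many components. An open
  normal \<open>N\<close> inside all their indices controls them, since a compatible family that is
  zero at \<open>N\<close> is zero at every larger index.\<close>

lemma cga_nhds_zero:
  fixes O' :: "('g set \<Rightarrow> 'g set \<Rightarrow> 'k::comm_ring_1) set"
  assumes "openin (completed_group_algebra_topology G T) O'"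
    and "\<zero>\<^bsub>completed_group_algebra G T\<^esub> \<in> O'"
  obtains N where "N \<in> open_normal G T"
    "\<And>a. \<lbrakk>a \<in> carrier (completed_group_algebra G T); \<And>C. a N C = 0\<rbrakk> \<Longrightarrow> a \<in> O'"
proof -
  let ?I = "open_normal G T"
  define X where "X = (\<lambda>N. discrete_topology (carrier (group_algebra (G Mod N)) :: ('g set \<Rightarrow> 'k) set))"
  define z where "z = (\<zero>\<^bsub>completed_group_algebra G T\<^esub> :: 'g set \<Rightarrow> 'g set \<Rightarrow> 'k)"
  have topX: "topspace (X M) = carrier (group_algebra (G Mod M))" for M by (simp add: X_def)
  have "\<exists>Q. openin (product_topology X ?I) Q \<and> O' = Q \<inter> carrier (completed_group_algebra G T)"
    using assms(1) unfolding completed_group_algebra_topology_def openin_subtopology X_def .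
  then obtain Q where Q: "openin (product_topology X ?I) Q"
    "O' = Q \<inter> carrier (completed_group_algebra G T)" by blast
  have "z \<in> Q" using assms(2) Q(2) unfolding z_def by blast
  obtain Y where Y: "finite {i \<in> ?I. Y i \<noteq> topspace (X i)}" "z \<in> Pi\<^sub>E ?I Y" "Pi\<^sub>E ?I Y \<subseteq> Q"
    by (rule product_topology_nhds[OF Q(1) \<open>z \<in> Q\<close>])
  define F where "F = {i \<in> ?I. Y i \<noteq> topspace (X i)}"
  have F1: "finite F" using Y(1) unfolding F_def .
  have F2: "F \<subseteq> ?I" unfolding F_def by (rule Collect_restrict)
  obtain N where N: "N \<in> ?I" "\<forall>M\<in>F. N \<subseteq> M"
    by (rule Inter_open_normal[OF F1 F2])
  show ?thesis
  proof (rule that[OF N(1)])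
    fix a :: "'g set \<Rightarrow> 'g set \<Rightarrow> 'k"
    assume a: "a \<in> carrier (completed_group_algebra G T)" and a0: "\<And>C. a N C = 0"
    have "a M \<in> Y M" if M: "M \<in> open_normal G T" for M
    proof (cases "M \<in> F")
      case True
      then have "group_algebra_map (\<lambda>C. M <#> C) (a N) = a M"
        using a N(1) bspec[OF N(2) True] M by (simp add: carrier_cga)
      then have "a M = group_algebra_map (\<lambda>C. M <#> C) (a N)" ..
      also have "\<dots> = z M"
        using M a0 unfolding z_def by (auto simp: group_algebra_map_def completed_group_algebra_def group_algebra_def)
      finally show ?thesis using PiE_mem[OF Y(2) M] by simp
    next
      case False
      then have "Y M = carrier (group_algebra (G Mod M))" using M topX unfolding F_def by simp
      then show ?thesis using a M by (simp add: carrier_cga carrier_group_algebra carrier_FactGroup)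
    qed
    then have "a \<in> Pi\<^sub>E (open_normal G T) Y"
      using a unfolding carrier_cga by (intro PiE_I) (auto simp: extensional_def)
    then have "a \<in> Q" using Y(3) by (rule rev_subsetD)
    then show "a \<in> O'" using a unfolding Q(2) by (rule IntI)
  qed
qed

end


section \<open>Quotients of profinite modules\<close>

text \<open>For a subgroup \<open>S\<close>, the predicate under the choice operator depends only on
  the coset of \<open>x\<close>. Equality of representatives is therefore congruence modulo
  \<open>S\<close>, and quotients can be treated without sets of cosets.\<close>

definition coset_rep :: "('a, 'm) ring_scheme \<Rightarrow> 'a set \<Rightarrow> 'a \<Rightarrow> 'a" where
  "coset_rep M S x = (SOME y. y \<in> carrier M \<and> x \<ominus>\<^bsub>M\<^esub> y \<in> S)"

text \<open>The quotient by \<open>S\<close> lives on chosen coset representatives, so its elements have the same type as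
  those of \<open>M\<close>; test modules for relative projectivity are confined to fixed types.\<close>

definition quotient_module :: "('r, 'm) top_module \<Rightarrow> 'm set \<Rightarrow> ('r, 'm) top_module" where
  "quotient_module M S =
    \<lparr>carrier = coset_rep M S ` carrier M, monoid.mult = monoid.mult M, monoid.one = monoid.one M,
     ring.zero = coset_rep M S \<zero>\<^bsub>M\<^esub>, ring.add = (\<lambda>x y. coset_rep M S (x \<oplus>\<^bsub>M\<^esub> y)),
     smult = (\<lambda>a x. coset_rep M S (a \<odot>\<^bsub>M\<^esub> x)),
     mtop = discrete_topology (coset_rep M S ` carrier M)\<rparr>"

definition open_submodule ::
    "('r, 'a) ring_scheme \<Rightarrow> ('r, 'm) top_module \<Rightarrow> 'm set \<Rightarrow> bool" where
  "open_submodule R M S \<longleftrightarrow>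
    subgroup S (add_monoid M) \<and> openin (mtop M) S \<and> (\<forall>a \<in> carrier R. \<forall>x \<in> S. a \<odot>\<^bsub>M\<^esub> x \<in> S)"

section \<open>Congruence modulo a subgroup of an abelian group\<close>

context abelian_group
begin

lemma subgroup_minus_closed:
  assumes "subgroup S (add_monoid G)" "x \<in> S" "y \<in> S"
  shows "x \<ominus> y \<in> S"
  using assms subgroup.m_closed[OF assms(1)] subgroup.m_inv_closed[OF assms(1)]
  by (simp add: a_minus_def a_inv_def)

context
  fixes S
  assumes S: "subgroup S (add_monoid G)"
begin

lemma subgroup_minus_trans:
  assumes "x \<ominus> y \<in> S" "y \<ominus> z \<in> S" "x \<in> carrier G" "y \<in> carrier G" "z \<in> carrier G"
  shows "x \<ominus> z \<in> S"
proof -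
  have "(x \<ominus> y) \<oplus> (y \<ominus> z) = x \<ominus> z"
    using assms by (simp add: a_minus_def a_assoc r_neg1)
  then show ?thesis using subgroup.m_closed[OF S assms(1,2)] by simp
qed

lemma subgroup_minus_sym:
  assumes "x \<ominus> y \<in> S" "x \<in> carrier G" "y \<in> carrier G"
  shows "y \<ominus> x \<in> S"
proof -
  have "\<zero> \<ominus> (x \<ominus> y) = y \<ominus> x"
    using assms by (simp add: a_minus_def minus_add a_comm)
  then show ?thesis
    using subgroup_minus_closed[OF S subgroup.one_closed[OF S] assms(1)] by simp
qed

lemma coset_rep_props:
  assumes "x \<in> carrier G"
  shows "coset_rep G S x \<in> carrier G" "x \<ominus> coset_rep G S x \<in> S"
proof -
  have "x \<ominus> x \<in> S" using assms subgroup.one_closed[OF S] by (simp add: a_minus_def r_neg)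
  then have "\<exists>y. y \<in> carrier G \<and> x \<ominus> y \<in> S" using assms by blast
  from someI_ex[OF this]
  show "coset_rep G S x \<in> carrier G" "x \<ominus> coset_rep G S x \<in> S"
    by (simp_all add: coset_rep_def)
qed

lemma coset_rep_eq_iff:
  assumes "x \<in> carrier G" "y \<in> carrier G"
  shows "coset_rep G S x = coset_rep G S y \<longleftrightarrow> x \<ominus> y \<in> S"
proof
  assume "coset_rep G S x = coset_rep G S y"
  then have "x \<ominus> coset_rep G S y \<in> S" using coset_rep_props[OF assms(1)] by simp
  moreover have "coset_rep G S y \<ominus> y \<in> S"
    using coset_rep_props[OF assms(2)] subgroup_minus_sym assms by blast
  ultimately show "x \<ominus> y \<in> S"
    using subgroup_minus_trans[of x "coset_rep G S y" y] assms coset_rep_props[OF assms(2)] by blast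
next
  assume xy: "x \<ominus> y \<in> S"
  then have yx: "y \<ominus> x \<in> S" using subgroup_minus_sym assms by blast
  have "(\<lambda>z. z \<in> carrier G \<and> x \<ominus> z \<in> S) = (\<lambda>z. z \<in> carrier G \<and> y \<ominus> z \<in> S)"
    using subgroup_minus_trans[OF xy] subgroup_minus_trans[OF yx] assms by (intro ext) blast
  then show "coset_rep G S x = coset_rep G S y" by (simp add: coset_rep_def)
qed

lemma coset_rep_idem:
  assumes "x \<in> carrier G"
  shows "coset_rep G S (coset_rep G S x) = coset_rep G S x"
  using coset_rep_props[OF assms] coset_rep_eq_iff subgroup_minus_sym assms by metis

lemma coset_rep_add_cong:
  assumes "coset_rep G S x = coset_rep G S x'" "coset_rep G S y = coset_rep G S y'"
    and "x \<in> carrier G" "x' \<in> carrier G" "y \<in> carrier G" "y' \<in> carrier G"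
  shows "coset_rep G S (x \<oplus> y) = coset_rep G S (x' \<oplus> y')"
proof -
  have "(x \<ominus> x') \<oplus> (y \<ominus> y') = (x \<oplus> y) \<ominus> (x' \<oplus> y')"
    using assms by (simp add: a_minus_def minus_add a_ac)
  moreover have "(x \<ominus> x') \<oplus> (y \<ominus> y') \<in> S"
    using assms subgroup.m_closed[OF S, of "x \<ominus> x'" "y \<ominus> y'"] by (simp add: coset_rep_eq_iff)
  ultimately show ?thesis using assms by (simp add: coset_rep_eq_iff)
qed

lemma coset_rep_add_left:
  assumes "x \<in> carrier G" "y \<in> carrier G"
  shows "coset_rep G S (coset_rep G S x \<oplus> y) = coset_rep G S (x \<oplus> y)"
  using assms by (intro coset_rep_add_cong) (simp_all add: coset_rep_idem coset_rep_props)

lemma coset_rep_add_right: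
  assumes "x \<in> carrier G" "y \<in> carrier G"
  shows "coset_rep G S (x \<oplus> coset_rep G S y) = coset_rep G S (x \<oplus> y)"
  using assms by (intro coset_rep_add_cong) (simp_all add: coset_rep_idem coset_rep_props)

end

lemma coset_rep_mono:
  assumes "subgroup S (add_monoid G)" "subgroup S' (add_monoid G)" "S \<subseteq> S'"
    "x \<in> carrier G" "y \<in> carrier G" "coset_rep G S x = coset_rep G S y"
  shows "coset_rep G S' x = coset_rep G S' y"
  using assms by (auto simp: coset_rep_eq_iff)

end

section \<open>Continuous homomorphisms and open submodules\<close>

lemma continuous_homD:
  assumes "f \<in> continuous_hom R M N"
  shows "x \<in> carrier M \<Longrightarrow> f x \<in> carrier N"
    "x \<in> carrier M \<Longrightarrow> y \<in> carrier M \<Longrightarrow> f (x \<oplus>\<^bsub>M\<^esub> y) = f x \<oplus>\<^bsub>N\<^esub> f y"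
    "a \<in> carrier R \<Longrightarrow> x \<in> carrier M \<Longrightarrow> f (a \<odot>\<^bsub>M\<^esub> x) = a \<odot>\<^bsub>N\<^esub> f x"
    "continuous_map (mtop M) (mtop N) f"
  using assms by (auto simp: continuous_hom_def hom_def)

lemma continuous_homI:
  assumes "\<And>x. x \<in> carrier M \<Longrightarrow> f x \<in> carrier N"
    "\<And>x y. x \<in> carrier M \<Longrightarrow> y \<in> carrier M \<Longrightarrow> f (x \<oplus>\<^bsub>M\<^esub> y) = f x \<oplus>\<^bsub>N\<^esub> f y"
    "\<And>a x. a \<in> carrier R \<Longrightarrow> x \<in> carrier M \<Longrightarrow> f (a \<odot>\<^bsub>M\<^esub> x) = a \<odot>\<^bsub>N\<^esub> f x"
    "continuous_map (mtop M) (mtop N) f"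
  shows "f \<in> continuous_hom R M N"
  using assms by (auto simp: continuous_hom_def hom_def)

text \<open>The record type of \<open>M\<close> is fixed without further fields, as
  \<open>quotient_module\<close>, \<open>open_submodule\<close> and \<open>continuous_hom\<close>
  require.\<close>

locale profinite_top_module = profinite_module R RT M
  for R :: "('r, 'a) ring_scheme" and RT :: "'r topology" and M :: "('r, 'm) top_module"
begin

sublocale additive: profinite_group "add_monoid M" "mtop M"
  by (rule profinite_add)

lemma topspace_mtop: "topspace (mtop M) = carrier M"
  using additive.topspace_eq by simp

lemma continuous_add_const:
  assumes "y \<in> carrier M"
  shows "continuous_map (mtop M) (mtop M) (\<lambda>x. x \<oplus>\<^bsub>M\<^esub> y)"
  using additive.continuous_translation[of y] assms by simp

lemma smult_minus:
  assumes "a \<in> carrier R" "x \<in> carrier M" "y \<in> carrier M"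
  shows "a \<odot>\<^bsub>M\<^esub> (x \<ominus>\<^bsub>M\<^esub> y) = a \<odot>\<^bsub>M\<^esub> x \<ominus>\<^bsub>M\<^esub> a \<odot>\<^bsub>M\<^esub> y"
proof -
  have "a \<odot>\<^bsub>M\<^esub> (x \<ominus>\<^bsub>M\<^esub> y) \<oplus>\<^bsub>M\<^esub> a \<odot>\<^bsub>M\<^esub> y = a \<odot>\<^bsub>M\<^esub> ((x \<ominus>\<^bsub>M\<^esub> y) \<oplus>\<^bsub>M\<^esub> y)"
    using assms by (simp add: smult_r_distr)
  also have "(x \<ominus>\<^bsub>M\<^esub> y) \<oplus>\<^bsub>M\<^esub> y = x"
    using assms by (simp add: a_minus_def M.a_assoc M.l_neg)
  finally have "a \<odot>\<^bsub>M\<^esub> x = a \<odot>\<^bsub>M\<^esub> (x \<ominus>\<^bsub>M\<^esub> y) \<oplus>\<^bsub>M\<^esub> a \<odot>\<^bsub>M\<^esub> y" ..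
  then show ?thesis
    using assms smult_closed by (simp add: a_minus_def M.a_assoc M.r_neg)
qed

lemma smult_zero:
  assumes "x \<in> carrier M"
  shows "\<zero>\<^bsub>R\<^esub> \<odot>\<^bsub>M\<^esub> x = \<zero>\<^bsub>M\<^esub>"
proof -
  have "\<zero>\<^bsub>R\<^esub> \<odot>\<^bsub>M\<^esub> x \<oplus>\<^bsub>M\<^esub> \<zero>\<^bsub>R\<^esub> \<odot>\<^bsub>M\<^esub> x = \<zero>\<^bsub>R\<^esub> \<odot>\<^bsub>M\<^esub> x"
    using smult_l_distr[of "\<zero>\<^bsub>R\<^esub>" "\<zero>\<^bsub>R\<^esub>" x] assms by simp
  then show ?thesis
    using assms smult_closed[of "\<zero>\<^bsub>R\<^esub>" x] by (simp add: M.add.l_cancel_one')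
qed

lemma carrier_open_submodule: "open_submodule R M (carrier M)"
  using M.add.subgroup_self openin_topspace[of "mtop M"] smult_closed
  by (simp add: open_submodule_def topspace_mtop)

lemma Int_open_submodule:
  assumes "open_submodule R M S" "open_submodule R M S'"
  shows "open_submodule R M (S \<inter> S')"
  using assms M.add.subgroups_Inter_pair[of S S'] by (auto simp: open_submodule_def)

text \<open>Open submodules are directed downwards, which later supplies the finite intersection
  property.\<close>

lemma Inter_open_submodule:
  assumes "finite F" "\<And>S. S \<in> F \<Longrightarrow> open_submodule R M S"
  shows "\<exists>S'. open_submodule R M S' \<and> (\<forall>S\<in>F. S' \<subseteq> S)"
  using assms
proof induction
  case empty
  then show ?case using carrier_open_submodule by auto
next
  case (insert S F)
  then obtain S' where "open_submodule R M S'" "\<forall>S\<in>F. S' \<subseteq> S" by auto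
  with insert have "open_submodule R M (S \<inter> S')" "\<forall>S''\<in>insert S F. S \<inter> S' \<subseteq> S''"
    by (auto intro: Int_open_submodule)
  then show ?case by blast
qed

section \<open>The finite quotient by an open submodule\<close>

context
  fixes S
  assumes S: "open_submodule R M S"
begin

lemma open_submodule_subgroup: "subgroup S (add_monoid M)"
  using S by (simp add: open_submodule_def)

lemma coset_rep_smult:
  assumes "a \<in> carrier R" "x \<in> carrier M" "y \<in> carrier M" "coset_rep M S x = coset_rep M S y"
  shows "coset_rep M S (a \<odot>\<^bsub>M\<^esub> x) = coset_rep M S (a \<odot>\<^bsub>M\<^esub> y)"
proof -
  have "x \<ominus>\<^bsub>M\<^esub> y \<in> S" using assms M.coset_rep_eq_iff[OF open_submodule_subgroup] by blast
  then have "a \<odot>\<^bsub>M\<^esub> (x \<ominus>\<^bsub>M\<^esub> y) \<in> S" using S assms(1) by (auto simp: open_submodule_def)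
  then show ?thesis
    using assms smult_closed by (simp add: smult_minus M.coset_rep_eq_iff[OF open_submodule_subgroup])
qed

lemma coset_rep_smult_rep:
  assumes "a \<in> carrier R" "x \<in> carrier M"
  shows "coset_rep M S (a \<odot>\<^bsub>M\<^esub> coset_rep M S x) = coset_rep M S (a \<odot>\<^bsub>M\<^esub> x)"
  using assms M.coset_rep_props[OF open_submodule_subgroup] M.coset_rep_idem[OF open_submodule_subgroup]
  by (intro coset_rep_smult) auto

lemma openin_coset_rep:
  assumes "x \<in> carrier M"
  shows "openin (mtop M) {y \<in> carrier M. coset_rep M S y = coset_rep M S x}"
proof -
  have "{y \<in> carrier M. coset_rep M S y = coset_rep M S x} =
      {y \<in> topspace (mtop M). y \<oplus>\<^bsub>M\<^esub> (\<ominus>\<^bsub>M\<^esub> x) \<in> S}"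
    using assms by (auto simp: M.coset_rep_eq_iff[OF open_submodule_subgroup] topspace_mtop a_minus_def)
  then show ?thesis
    using openin_continuous_map_preimage[OF continuous_add_const[of "\<ominus>\<^bsub>M\<^esub> x"], of S] S assms
    by (simp add: open_submodule_def)
qed

lemma continuous_coset_rep:
  "continuous_map (mtop M) (discrete_topology (coset_rep M S ` carrier M)) (coset_rep M S)"
  unfolding continuous_map_discrete_iff using openin_coset_rep by (auto simp: topspace_mtop)

text \<open>A continuous image of the compact module in a discrete space is compact, hence
  finite.\<close>

lemma finite_coset_rep: "finite (coset_rep M S ` carrier M)"
proof -
  have "compactin (discrete_topology (coset_rep M S ` carrier M)) (coset_rep M S ` topspace (mtop M))"
    using image_compactin[OF _ continuous_coset_rep] additive.compact unfolding compact_space_def by blast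
  then show ?thesis by (simp add: topspace_mtop compactin_discrete_topology)
qed

text \<open>The module laws descend because all operations are compatible with passing to
  representatives; the topological conditions hold because the space is finite and discrete. The
  quotient can thus serve as a test module.\<close>

lemma profinite_quotient_module: "profinite_module R RT (quotient_module M S)"
proof -
  note [simp] = M.coset_rep_props(1)[OF open_submodule_subgroup] M.coset_rep_idem[OF open_submodule_subgroup]
    M.coset_rep_add_left[OF open_submodule_subgroup] M.coset_rep_add_right[OF open_submodule_subgroup]
    coset_rep_smult_rep smult_closed
  let ?Q = "quotient_module M S"
  have ab: "abelian_group ?Q"
  proof (rule abelian_groupI)
    fix x assume "x \<in> carrier ?Q"
    then obtain x' where x': "x' \<in> carrier M" "x = coset_rep M S x'" by (auto simp: quotient_module_def)
    then show "\<exists>y\<in>carrier ?Q. y \<oplus>\<^bsub>?Q\<^esub> x = \<zero>\<^bsub>?Q\<^esub>"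
      by (intro bexI[of _ "coset_rep M S (\<ominus>\<^bsub>M\<^esub> x')"]) (simp_all add: quotient_module_def M.l_neg)
    fix y assume "y \<in> carrier ?Q"
    then obtain y' where "y' \<in> carrier M" "y = coset_rep M S y'" by (auto simp: quotient_module_def)
    then show "x \<oplus>\<^bsub>?Q\<^esub> y = y \<oplus>\<^bsub>?Q\<^esub> x"
      using x' by (simp add: quotient_module_def M.a_comm)
  qed (auto simp: quotient_module_def M.a_assoc)
  have lm: "left_module R ?Q"
  proof (intro left_module.intro left_module_axioms.intro R.ring_axioms ab)
    fix a b x assume ab: "a \<in> carrier R" "b \<in> carrier R" and "x \<in> carrier ?Q"
    then obtain x' where x': "x' \<in> carrier M" "x = coset_rep M S x'" by (auto simp: quotient_module_def)
    show "(a \<oplus>\<^bsub>R\<^esub> b) \<odot>\<^bsub>?Q\<^esub> x = a \<odot>\<^bsub>?Q\<^esub> x \<oplus>\<^bsub>?Q\<^esub> b \<odot>\<^bsub>?Q\<^esub> x"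
      using smult_l_distr[of a b x'] x' ab by (simp add: quotient_module_def)
    show "(a \<otimes>\<^bsub>R\<^esub> b) \<odot>\<^bsub>?Q\<^esub> x = a \<odot>\<^bsub>?Q\<^esub> (b \<odot>\<^bsub>?Q\<^esub> x)"
      using smult_assoc[of a b x'] x' ab by (simp add: quotient_module_def)
  qed (auto simp: quotient_module_def smult_r_distr smult_one)
  have grp: "group (add_monoid ?Q)" using ab abelian_group.a_group by blast
  interpret Q: group "add_monoid ?Q" by (rule grp)
  let ?D = "coset_rep M S ` carrier M"
  have "profinite_group (add_monoid ?Q) (mtop ?Q)"
  proof (intro profinite_group.intro grp profinite_group_axioms.intro)
    show "topspace (mtop ?Q) = carrier (add_monoid ?Q)" by (simp add: quotient_module_def)
    show "continuous_map (prod_topology (mtop ?Q) (mtop ?Q)) (mtop ?Q) (\<lambda>(x, y). x \<otimes>\<^bsub>add_monoid ?Q\<^esub> y)"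
      by (auto simp: quotient_module_def prod_topology_discrete_topology[symmetric])
    have "inv\<^bsub>add_monoid ?Q\<^esub> x \<in> ?D" if "x \<in> ?D" for x
      using that Q.inv_closed[of x] by (simp add: quotient_module_def)
    then show "continuous_map (mtop ?Q) (mtop ?Q) (\<lambda>x. inv\<^bsub>add_monoid ?Q\<^esub> x)"
      by (auto simp: quotient_module_def)
    show "compact_space (mtop ?Q)"
      using finite_coset_rep by (simp add: quotient_module_def compact_space_discrete_topology)
    show "Hausdorff_space (mtop ?Q)"
      by (simp add: quotient_module_def)
    show "\<exists>a. A \<subseteq> {a}" if "connectedin (mtop ?Q) A" for A
      using that by (simp add: quotient_module_def connectedin_discrete_topology)
  qed
  moreover have "continuous_map (prod_topology RT (mtop ?Q)) (mtop ?Q) (\<lambda>(a, x). a \<odot>\<^bsub>?Q\<^esub> x)"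
  proof -
    \<comment> \<open>The representatives, taken as a discrete space, map continuously into
      \<open>M\<close>. The action on the quotient is the composite of this map, the action on
      \<open>M\<close> and the reduction \<open>coset_rep M S\<close>.\<close>
    have "continuous_map (discrete_topology ?D) (mtop M) id"
      by (auto simp: topspace_mtop)
    from continuous_map_compose[OF continuous_map_snd this, of RT]
    have "continuous_map (prod_topology RT (discrete_topology ?D)) (prod_topology RT (mtop M)) (\<lambda>z. z)"
      by (simp add: continuous_map_pairwise o_def continuous_map_fst)
    from continuous_map_compose[OF continuous_map_compose[OF this continuous_smult] continuous_coset_rep]
    show ?thesis by (simp add: quotient_module_def o_def split_def)
  qed
  ultimately show ?thesis
    using lm by (intro profinite_module.intro profinite_module_axioms.intro)
qed

lemma quotient_module_simps:
  "carrier (quotient_module M S) = coset_rep M S ` carrier M"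
  "x \<oplus>\<^bsub>quotient_module M S\<^esub> y = coset_rep M S (x \<oplus>\<^bsub>M\<^esub> y)"
  "a \<odot>\<^bsub>quotient_module M S\<^esub> x = coset_rep M S (a \<odot>\<^bsub>M\<^esub> x)"
  "mtop (quotient_module M S) = discrete_topology (coset_rep M S ` carrier M)"
  by (simp_all add: quotient_module_def)

lemma coset_rep_continuous_hom: "coset_rep M S \<in> continuous_hom R M (quotient_module M S)"
  using continuous_coset_rep smult_closed
  by (intro continuous_homI)
    (simp_all add: quotient_module_simps M.coset_rep_add_left[OF open_submodule_subgroup]
      M.coset_rep_add_right[OF open_submodule_subgroup] coset_rep_smult_rep
      M.coset_rep_props(1)[OF open_submodule_subgroup])

end

text \<open>An open subgroup \<open>A\<close> inside \<open>O'\<close> exists by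
  \<open>open_subgroup_base\<close>; it is then shrunk to the elements whose whole orbit under
  scalars stays in \<open>A\<close>.\<close>

lemma open_submodule_base_zero:
  assumes RT: "compact_space RT" "topspace RT = carrier R"
    and "openin (mtop M) O'" "\<zero>\<^bsub>M\<^esub> \<in> O'"
  obtains S where "open_submodule R M S" "S \<subseteq> O'"
proof -
  obtain A where A: "subgroup A (add_monoid M)" "openin (mtop M) A" "A \<subseteq> O'"
    using additive.open_subgroup_base[of O'] assms by auto
  let ?P = "{z \<in> topspace (prod_topology RT (mtop M)). (case z of (a, x) \<Rightarrow> a \<odot>\<^bsub>M\<^esub> x) \<in> A}"
  \<comment> \<open>The largest submodule contained in \<open>A\<close>. It is open by the tube
    lemma because the scalars form a compact space, and it lies in \<open>A\<close> because
    \<open>R\<close> has a unit.\<close>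
  define S where "S = {x \<in> topspace (mtop M). \<forall>a\<in>topspace RT. (a, x) \<in> ?P}"
  have "openin (prod_topology RT (mtop M)) ?P"
    by (rule openin_continuous_map_preimage[OF continuous_smult A(2)])
  then have "openin (mtop M) S"
    unfolding S_def by (rule openin_Collect_Ball_compact[OF RT(1) closedin_topspace])
  have S_eq: "S = {x \<in> carrier M. \<forall>a\<in>carrier R. a \<odot>\<^bsub>M\<^esub> x \<in> A}"
    using RT by (auto simp: S_def topspace_mtop)
  have "open_submodule R M S"
    unfolding open_submodule_def
  proof (intro conjI ballI \<open>openin (mtop M) S\<close>)
    show "subgroup S (add_monoid M)"
    proof (rule group.subgroupI[OF M.a_group])
      show "S \<subseteq> carrier (add_monoid M)" by (auto simp: S_eq)
      have smult_r_zero: "a \<odot>\<^bsub>M\<^esub> \<zero>\<^bsub>M\<^esub> = \<zero>\<^bsub>M\<^esub>" if "a \<in> carrier R" for a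
        using smult_minus[OF that M.zero_closed M.zero_closed] smult_closed[OF that M.zero_closed]
        by (simp add: a_minus_def M.r_neg)
      have z: "\<zero>\<^bsub>M\<^esub> \<in> S"
        using subgroup.one_closed[OF A(1)] by (simp add: S_eq smult_r_zero)
      then show "S \<noteq> {}" by blast
      have minus: "x \<ominus>\<^bsub>M\<^esub> y \<in> S" if "x \<in> S" "y \<in> S" for x y
        using that M.subgroup_minus_closed[OF A(1)] by (simp add: S_eq smult_minus)
      show inv: "inv\<^bsub>add_monoid M\<^esub> x \<in> S" if "x \<in> S" for x
        using minus[OF z that] that by (simp add: S_eq a_minus_def a_inv_def[symmetric])
      show "x \<otimes>\<^bsub>add_monoid M\<^esub> y \<in> S" if "x \<in> S" "y \<in> S" for x y
        using that subgroup.m_closed[OF A(1)] by (simp add: S_eq smult_r_distr)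
    qed
    fix a x assume ax: "a \<in> carrier R" "x \<in> S"
    have "b \<odot>\<^bsub>M\<^esub> (a \<odot>\<^bsub>M\<^esub> x) \<in> A" if "b \<in> carrier R" for b
      using ax that R.m_closed[of b a] by (simp add: S_eq flip: smult_assoc)
    then show "a \<odot>\<^bsub>M\<^esub> x \<in> S" using ax smult_closed by (simp add: S_eq)
  qed
  moreover have "S \<subseteq> A"
    using smult_one by (auto simp: S_eq) (metis R.one_closed)
  ultimately show ?thesis using that A(3) by blast
qed

lemma open_submodule_base:
  assumes RT: "compact_space RT" "topspace RT = carrier R"
    and O': "openin (mtop M) O'" "x \<in> O'"
  obtains S where "open_submodule R M S"
    "\<forall>y \<in> carrier M. coset_rep M S y = coset_rep M S x \<longrightarrow> y \<in> O'"
proof -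
  have x: "x \<in> carrier M" using O' openin_subset topspace_mtop by blast
  let ?O = "{y \<in> topspace (mtop M). y \<oplus>\<^bsub>M\<^esub> x \<in> O'}"
  have "openin (mtop M) ?O"
    by (rule openin_continuous_map_preimage[OF continuous_add_const[OF x] O'(1)])
  moreover have "\<zero>\<^bsub>M\<^esub> \<in> ?O" using x O' by (simp add: topspace_mtop)
  ultimately obtain S where S: "open_submodule R M S" "S \<subseteq> ?O"
    by (rule open_submodule_base_zero[OF RT])
  have "y \<in> O'" if y: "y \<in> carrier M" "coset_rep M S y = coset_rep M S x" for y
  proof -
    have "y \<ominus>\<^bsub>M\<^esub> x \<in> S"
      using y x M.coset_rep_eq_iff[OF open_submodule_subgroup[OF S(1)]] by blast
    then have "(y \<ominus>\<^bsub>M\<^esub> x) \<oplus>\<^bsub>M\<^esub> x \<in> O'" using S(2) by blast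
    then show ?thesis using x y by (simp add: a_minus_def M.a_assoc M.l_neg)
  qed
  then show ?thesis using that S(1) by blast
qed

text \<open>Open submodules separate points: the complement of \<open>{y}\<close> is open, so for
  \<open>x \<noteq> y\<close> it contains the coset of \<open>x\<close> modulo some open
  submodule.\<close>

lemma eq_if_coset_rep_eq:
  assumes RT: "compact_space RT" "topspace RT = carrier R"
    and xy: "x \<in> carrier M" "y \<in> carrier M"
    and eq: "\<And>S. open_submodule R M S \<Longrightarrow> coset_rep M S x = coset_rep M S y"
  shows "x = y"
proof (rule ccontr)
  assume "x \<noteq> y"
  have "closedin (mtop M) {y}"
    using additive.Hausdorff xy by (simp add: closedin_Hausdorff_singleton topspace_mtop)
  then have "openin (mtop M) (topspace (mtop M) - {y})" by blast
  moreover have "x \<in> topspace (mtop M) - {y}" using \<open>x \<noteq> y\<close> xy by (simp add: topspace_mtop)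
  ultimately obtain S where "open_submodule R M S"
    "\<forall>z \<in> carrier M. coset_rep M S z = coset_rep M S x \<longrightarrow> z \<in> topspace (mtop M) - {y}"
    by (rule open_submodule_base[OF RT])
  then show False using eq xy by auto
qed

end

section \<open>Homomorphisms between profinite modules\<close>

lemma profinite_top_moduleI:
  "profinite_module R RT M \<Longrightarrow> profinite_top_module R RT M"
  by (rule profinite_top_module.intro)

lemma continuous_hom_compose:
  assumes "f \<in> continuous_hom R L M" "g \<in> continuous_hom R M N"
  shows "(\<lambda>x. g (f x)) \<in> continuous_hom R L N"
  using continuous_homD[OF assms(1)] continuous_homD[OF assms(2)]
    continuous_map_compose[of "mtop L" "mtop M" f "mtop N" g]
  by (intro continuous_homI) (simp_all add: o_def)

lemma continuous_hom_cong:
  assumes "f \<in> continuous_hom R M N" "\<And>x. x \<in> carrier M \<Longrightarrow> f x = g x" "profinite_top_module R RT M"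
  shows "g \<in> continuous_hom R M N"
proof -
  interpret M: profinite_top_module R RT M by fact
  show ?thesis
  proof (rule continuous_homI)
    show "continuous_map (mtop M) (mtop N) g"
      by (rule continuous_map_eq[OF continuous_homD(4)[OF assms(1)]]) (simp add: assms(2) M.topspace_mtop)
  qed (simp_all add: continuous_homD(1-3)[OF assms(1)] M.smult_closed flip: assms(2))
qed

lemma continuous_hom_group_hom:
  assumes "profinite_top_module R RT M" "profinite_top_module R RT N" "f \<in> continuous_hom R M N"
  shows "group_hom (add_monoid M) (add_monoid N) f"
proof -
  interpret M: profinite_top_module R RT M by fact
  interpret N: profinite_top_module R RT N by fact
  show ?thesis
    using assms(3) M.M.a_group N.M.a_group
    by (intro group_hom.intro group_hom_axioms.intro) (auto simp: continuous_hom_def)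
qed

lemma continuous_hom_minus:
  assumes "profinite_top_module R RT M" "profinite_top_module R RT N" "f \<in> continuous_hom R M N"
    and "x \<in> carrier M" "y \<in> carrier M"
  shows "f (x \<ominus>\<^bsub>M\<^esub> y) = f x \<ominus>\<^bsub>N\<^esub> f y"
proof -
  interpret M: profinite_top_module R RT M by fact
  have "f (\<ominus>\<^bsub>M\<^esub> y) = \<ominus>\<^bsub>N\<^esub> f y"
    using group_hom.hom_inv[OF continuous_hom_group_hom[OF assms(1-3)], of y] assms
    by (simp add: a_inv_def)
  then show ?thesis
    using assms continuous_homD(2)[OF assms(3), of x "\<ominus>\<^bsub>M\<^esub> y"] by (simp add: a_minus_def)
qed

text \<open>The equaliser of \<open>f\<close> and \<open>g\<close> is a submodule, closed because
  the target is Hausdorff. It contains the topological generators, hence everything.\<close>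

lemma continuous_hom_eq_if_eq_on_generators:
  assumes M: "profinite_top_module R RT M" and N: "profinite_top_module R RT N"
    and f: "f \<in> continuous_hom R M N" and g: "g \<in> continuous_hom R M N"
    and X: "\<Inter>{S. closed_submodule R M S \<and> X \<subseteq> S} = carrier M" "X \<subseteq> carrier M"
    and eq: "\<And>x. x \<in> X \<Longrightarrow> f x = g x" and u: "u \<in> carrier M"
  shows "f u = g u"
proof -
  interpret M: profinite_top_module R RT M by fact
  interpret N: profinite_top_module R RT N by fact
  interpret f: group_hom "add_monoid M" "add_monoid N" f by (rule continuous_hom_group_hom[OF M N f])
  interpret g: group_hom "add_monoid M" "add_monoid N" g by (rule continuous_hom_group_hom[OF M N g])
  let ?E = "{x \<in> carrier M. f x = g x}"
  have "closedin (mtop M) ?E"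
    using closedin_continuous_maps_eq[OF N.additive.Hausdorff continuous_homD(4)[OF f] continuous_homD(4)[OF g]]
    by (simp add: M.topspace_mtop)
  moreover have "subgroup ?E (add_monoid M)"
  proof (rule group.subgroupI[OF M.M.a_group])
    show "?E \<noteq> {}" using f.hom_one g.hom_one M.M.zero_closed by force
    show "inv\<^bsub>add_monoid M\<^esub> x \<in> ?E" if "x \<in> ?E" for x
      using that f.hom_inv[of x] g.hom_inv[of x] group.inv_closed[OF M.M.a_group, of x] by simp
    show "x \<otimes>\<^bsub>add_monoid M\<^esub> y \<in> ?E" if "x \<in> ?E" "y \<in> ?E" for x y
      using that continuous_homD(2)[OF f] continuous_homD(2)[OF g] by simp
  qed auto
  moreover have "\<forall>a\<in>carrier R. \<forall>x\<in>?E. a \<odot>\<^bsub>M\<^esub> x \<in> ?E"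
    using M.smult_closed continuous_homD(3)[OF f] continuous_homD(3)[OF g] by simp
  ultimately have "closed_submodule R M ?E" by (simp add: closed_submodule_def)
  moreover have "X \<subseteq> ?E" using X(2) eq by blast
  ultimately have "carrier M \<subseteq> ?E" unfolding X(1)[symmetric] by blast
  then show ?thesis using u by blast
qed

lemma open_submodule_image:
  assumes V: "profinite_top_module R RT V" and W: "profinite_top_module R RT W"
    and \<beta>: "\<beta> \<in> continuous_hom R V W" and surj: "\<beta> ` carrier V = carrier W"
    and S: "open_submodule R V S"
  shows "open_submodule R W (\<beta> ` S)"
proof -
  interpret V: profinite_top_module R RT V by fact
  interpret W: profinite_top_module R RT W by fact
  interpret \<beta>: group_hom "add_monoid V" "add_monoid W" \<beta> by (rule continuous_hom_group_hom[OF V W \<beta>])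
  note sub = V.open_submodule_subgroup[OF S]
  have SV: "S \<subseteq> carrier V" using subgroup.subset[OF sub] by simp
  have "subgroup (\<beta> ` S) (add_monoid W)" by (rule \<beta>.subgroup_img_is_subgroup[OF sub])
  moreover have "openin (mtop W) (\<beta> ` S)"
  proof -
    have "quotient_map (mtop V) (mtop W) \<beta>"
      using continuous_homD(4)[OF \<beta>] V.additive.compact W.additive.Hausdorff surj
      by (intro continuous_imp_quotient_map) (simp_all add: V.topspace_mtop W.topspace_mtop)
    moreover have "openin (mtop V) {x \<in> topspace (mtop V). \<beta> x \<in> \<beta> ` S}"
    proof -
      \<comment> \<open>The preimage is \<open>S\<close> plus the kernel of \<open>\<beta>\<close>,
        a union of open cosets of \<open>S\<close>.\<close>
      have "{x \<in> topspace (mtop V). \<beta> x \<in> \<beta> ` S} =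
        (\<Union>x\<in>{x \<in> carrier V. \<beta> x \<in> \<beta> ` S}. {y \<in> carrier V. coset_rep V S y = coset_rep V S x})"
      proof (intro equalityI subsetI)
        fix y assume "y \<in> (\<Union>x\<in>{x \<in> carrier V. \<beta> x \<in> \<beta> ` S}. {y \<in> carrier V. coset_rep V S y = coset_rep V S x})"
        then obtain x s where x: "x \<in> carrier V" "s \<in> S" "\<beta> x = \<beta> s" and y: "y \<in> carrier V"
          "coset_rep V S y = coset_rep V S x" by blast
        then have d: "y \<ominus>\<^bsub>V\<^esub> x \<in> S" using V.M.coset_rep_eq_iff[OF sub] by blast
        have sV: "s \<in> carrier V" using x SV by blast
        have "\<beta> y = \<beta> ((y \<ominus>\<^bsub>V\<^esub> x) \<oplus>\<^bsub>V\<^esub> x)"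
          using x y by (simp add: a_minus_def V.M.a_assoc V.M.l_neg)
        also have "\<dots> = \<beta> ((y \<ominus>\<^bsub>V\<^esub> x) \<oplus>\<^bsub>V\<^esub> s)"
          using continuous_homD(2)[OF \<beta>] x y sV by simp
        finally show "y \<in> {x \<in> topspace (mtop V). \<beta> x \<in> \<beta> ` S}"
          using subgroup.m_closed[OF sub d x(2)] y by (simp add: V.topspace_mtop)
      qed (auto simp: V.topspace_mtop)
      also have "openin (mtop V) \<dots>"
        using V.openin_coset_rep[OF S] by (intro openin_Union) blast
      finally show ?thesis .
    qed
    moreover have "\<beta> ` S \<subseteq> topspace (mtop W)" using SV surj by (auto simp: W.topspace_mtop)
    ultimately show ?thesis unfolding quotient_map_def by blast
  qed
  moreover have "\<forall>a\<in>carrier R. \<forall>x\<in>\<beta> ` S. a \<odot>\<^bsub>W\<^esub> x \<in> \<beta> ` S"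
  proof (intro ballI)
    fix a x assume a: "a \<in> carrier R" and "x \<in> \<beta> ` S"
    then obtain s where s: "s \<in> S" "x = \<beta> s" by blast
    then have "a \<odot>\<^bsub>W\<^esub> x = \<beta> (a \<odot>\<^bsub>V\<^esub> s)" using continuous_homD(3)[OF \<beta> a, of s] SV by auto
    moreover have "a \<odot>\<^bsub>V\<^esub> s \<in> S" using S a s by (auto simp: open_submodule_def)
    ultimately show "a \<odot>\<^bsub>W\<^esub> x \<in> \<beta> ` S" by blast
  qed
  ultimately show ?thesis by (simp add: open_submodule_def)
qed

text \<open>The scalars that send all of \<open>M\<close> into \<open>S\<close> form a neighbourhood
  of zero, because \<open>M\<close> is compact. It contains every scalar vanishing at some level
  \<open>N\<close>, so \<open>k[[G]]\<close> acts on \<open>M/S\<close> through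
  \<open>k[G/N]\<close>.\<close>

lemma (in profinite_group) smult_factors_open_normal:
  fixes M :: "('g set \<Rightarrow> 'g set \<Rightarrow> 'k::comm_ring_1, 'm) top_module"
  assumes M: "profinite_cga_module G T M"
    and S: "open_submodule (completed_group_algebra G T) M S"
  obtains N where "N \<in> open_normal G T"
    "\<And>a b x. \<lbrakk>a \<in> carrier (completed_group_algebra G T); b \<in> carrier (completed_group_algebra G T);
      a N = b N; x \<in> carrier M\<rbrakk> \<Longrightarrow> coset_rep M S (a \<odot>\<^bsub>M\<^esub> x) = coset_rep M S (b \<odot>\<^bsub>M\<^esub> x)"
proof -
  let ?R = "completed_group_algebra G T :: ('g set \<Rightarrow> 'g set \<Rightarrow> 'k) ring"
  let ?RT = "completed_group_algebra_topology G T :: ('g set \<Rightarrow> 'g set \<Rightarrow> 'k) topology"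
  interpret M: profinite_top_module ?R ?RT M by (rule profinite_top_moduleI[OF M])
  note sub = M.open_submodule_subgroup[OF S]
  \<comment> \<open>The factors are swapped because \<open>openin_Collect_Ball_compact\<close>
    expects the compact factor, here \<open>M\<close>, in first place.\<close>
  have "continuous_map (prod_topology (mtop M) ?RT) (prod_topology ?RT (mtop M)) (\<lambda>z. (snd z, fst z))"
    by (simp add: continuous_map_pairwise o_def continuous_map_fst continuous_map_snd)
  from continuous_map_compose[OF this M.continuous_smult]
  have c: "continuous_map (prod_topology (mtop M) ?RT) (mtop M) (\<lambda>z. snd z \<odot>\<^bsub>M\<^esub> fst z)"
    by (simp add: o_def)
  have oS: "openin (mtop M) S" using S by (simp add: open_submodule_def)
  define A where "A = {a \<in> topspace ?RT. \<forall>x\<in>topspace (mtop M).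
    (x, a) \<in> {z \<in> topspace (prod_topology (mtop M) ?RT). snd z \<odot>\<^bsub>M\<^esub> fst z \<in> S}}"
  have "openin ?RT A"
    unfolding A_def
    by (rule openin_Collect_Ball_compact[OF M.additive.compact closedin_topspace
          openin_continuous_map_preimage[OF c oS]])
  moreover have "\<zero>\<^bsub>?R\<^esub> \<in> A"
    using subgroup.one_closed[OF sub] M.R.zero_closed
    by (simp add: A_def topspace_cga_topology M.topspace_mtop M.smult_zero)
  ultimately obtain N where N: "N \<in> open_normal G T"
    "\<And>a. \<lbrakk>a \<in> carrier ?R; \<And>C. a N C = 0\<rbrakk> \<Longrightarrow> a \<in> A"
    by (rule cga_nhds_zero) blast
  show ?thesis
  proof (rule that[OF N(1)])
    fix a b x assume ab: "a \<in> carrier ?R" "b \<in> carrier ?R" "a N = b N" and x: "x \<in> carrier M"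
    define d where "d = a \<ominus>\<^bsub>?R\<^esub> b"
    have d: "d \<in> carrier ?R" using ab by (simp add: d_def)
    have ad: "a = d \<oplus>\<^bsub>?R\<^esub> b"
      using ab by (simp add: d_def a_minus_def M.R.a_assoc M.R.l_neg)
    have "a N C = d N C + b N C" for C
      by (subst ad) (simp add: completed_group_algebra_def group_algebra_def N(1))
    then have "d N C = 0" for C using ab(3) by simp
    then have "d \<in> A" using N(2) d by blast
    then have "d \<odot>\<^bsub>M\<^esub> x \<in> S" using x by (simp add: A_def M.topspace_mtop)
    moreover have "a \<odot>\<^bsub>M\<^esub> x \<ominus>\<^bsub>M\<^esub> b \<odot>\<^bsub>M\<^esub> x = d \<odot>\<^bsub>M\<^esub> x"
    proof -
      have "a \<odot>\<^bsub>M\<^esub> x = d \<odot>\<^bsub>M\<^esub> x \<oplus>\<^bsub>M\<^esub> b \<odot>\<^bsub>M\<^esub> x"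
        by (subst ad) (rule M.smult_l_distr[OF d ab(2) x])
      then show ?thesis
        using M.smult_closed d ab x by (simp add: a_minus_def M.M.a_assoc M.M.r_neg)
    qed
    ultimately show "coset_rep M S (a \<odot>\<^bsub>M\<^esub> x) = coset_rep M S (b \<odot>\<^bsub>M\<^esub> x)"
      using M.smult_closed ab x by (simp add: M.M.coset_rep_eq_iff[OF sub])
  qed
qed


section \<open>Lifts modulo open submodules\<close>

text \<open>Only the reduction of \<open>f\<close> modulo \<open>S\<close> has to be a homomorphism;
  \<open>f\<close> itself is an arbitrary map into \<open>V\<close>. Lifts for all \<open>S\<close>
  are thus points of one product space, and compactness can compare them.\<close>

definition lift_modulo where
  "lift_modulo R U V W \<beta> \<phi> S f \<longleftrightarrow>
    f \<in> carrier U \<rightarrow>\<^sub>E carrier V \<and>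
    (\<lambda>u. coset_rep V S (f u)) \<in> continuous_hom R U (quotient_module V S) \<and>
    (\<forall>u \<in> carrier U. coset_rep W (\<beta> ` S) (\<beta> (f u)) = coset_rep W (\<beta> ` S) (\<phi> u))"

lemma lift_moduloD:
  assumes "lift_modulo R U V W \<beta> \<phi> S f"
  shows "f \<in> carrier U \<rightarrow>\<^sub>E carrier V"
    "(\<lambda>u. coset_rep V S (f u)) \<in> continuous_hom R U (quotient_module V S)"
    "u \<in> carrier U \<Longrightarrow> coset_rep W (\<beta> ` S) (\<beta> (f u)) = coset_rep W (\<beta> ` S) (\<phi> u)"
  using assms by (simp_all add: lift_modulo_def)

locale lifting_problem =
  U: profinite_top_module R RT U + V: profinite_top_module R RT V + W: profinite_top_module R RT W
  for R :: "('r, 'a) ring_scheme" and RT :: "'r topology"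
    and U :: "('r, 'u) top_module" and V :: "('r, 'v) top_module" and W :: "('r, 'w) top_module" +
  fixes \<beta> \<phi>
  assumes compact_RT: "compact_space RT" and topspace_RT: "topspace RT = carrier R"
    and beta: "\<beta> \<in> continuous_hom R V W" and surj: "\<beta> ` carrier V = carrier W"
    and phi: "\<phi> \<in> continuous_hom R U W"
begin

lemma profinite_U: "profinite_top_module R RT U" ..

lemma profinite_V: "profinite_top_module R RT V" ..

lemma profinite_W: "profinite_top_module R RT W" ..

lemma beta_coset_rep:
  assumes S: "open_submodule R V S" and "x \<in> carrier V" "y \<in> carrier V" "coset_rep V S x = coset_rep V S y"
  shows "coset_rep W (\<beta> ` S) (\<beta> x) = coset_rep W (\<beta> ` S) (\<beta> y)"
proof -
  have "x \<ominus>\<^bsub>V\<^esub> y \<in> S"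
    using assms V.M.coset_rep_eq_iff[OF V.open_submodule_subgroup[OF S]] by blast
  then have "\<beta> x \<ominus>\<^bsub>W\<^esub> \<beta> y \<in> \<beta> ` S"
    using continuous_hom_minus[OF profinite_V profinite_W beta, of x y] assms by (metis imageI)
  then show ?thesis
    using W.M.coset_rep_eq_iff[OF W.open_submodule_subgroup[OF open_submodule_image[OF profinite_V profinite_W beta surj S]]]
      assms continuous_homD(1)[OF beta] by blast
qed

text \<open>A lift may be changed pointwise by elements of \<open>S\<close>. This passes the
  property from a nearby lift to a limit in \<open>closedin_lift_modulo\<close>.\<close>

lemma lift_modulo_cong:
  assumes S: "open_submodule R V S" and g: "lift_modulo R U V W \<beta> \<phi> S g"
    and f: "f \<in> carrier U \<rightarrow>\<^sub>E carrier V"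
    and eq: "\<And>u. u \<in> carrier U \<Longrightarrow> coset_rep V S (f u) = coset_rep V S (g u)"
  shows "lift_modulo R U V W \<beta> \<phi> S f"
proof -
  note g' = lift_moduloD[OF g]
  have "(\<lambda>u. coset_rep V S (f u)) \<in> continuous_hom R U (quotient_module V S)"
    by (rule continuous_hom_cong[OF g'(2) eq[symmetric] profinite_U])
  moreover have "coset_rep W (\<beta> ` S) (\<beta> (f u)) = coset_rep W (\<beta> ` S) (\<phi> u)" if u: "u \<in> carrier U" for u
    using beta_coset_rep[OF S PiE_mem[OF f u] PiE_mem[OF g'(1) u] eq[OF u]] g'(3)[OF u] by simp
  ultimately show ?thesis using f unfolding lift_modulo_def by (intro conjI ballI)
qed

text \<open>The reduction is composed with the projection \<open>V/S \<rightarrow> V/S'\<close>. A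
  lift modulo one small submodule thereby serves finitely many larger ones at once.\<close>

lemma lift_modulo_mono:
  assumes S: "open_submodule R V S" and S': "open_submodule R V S'" and le: "S \<subseteq> S'"
    and f: "lift_modulo R U V W \<beta> \<phi> S f"
  shows "lift_modulo R U V W \<beta> \<phi> S' f"
proof -
  note sub = V.open_submodule_subgroup[OF S] and sub' = V.open_submodule_subgroup[OF S']
  have mono: "coset_rep V S' x = coset_rep V S' y"
    if "coset_rep V S x = coset_rep V S y" "x \<in> carrier V" "y \<in> carrier V" for x y
    using V.M.coset_rep_mono[OF sub sub' le] that by blast
  have rr: "coset_rep V S' (coset_rep V S x) = coset_rep V S' x" if "x \<in> carrier V" for x
    using that by (intro mono) (simp_all add: V.M.coset_rep_idem[OF sub] V.M.coset_rep_props(1)[OF sub])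
  have "coset_rep V S' \<in> continuous_hom R (quotient_module V S) (quotient_module V S')"
  proof (rule continuous_homI)
    fix x y assume "x \<in> carrier (quotient_module V S)" "y \<in> carrier (quotient_module V S)"
    then have "x \<in> carrier V" "y \<in> carrier V"
      by (auto simp: V.quotient_module_simps[OF S] V.M.coset_rep_props(1)[OF sub])
    then show "coset_rep V S' (x \<oplus>\<^bsub>quotient_module V S\<^esub> y) =
        coset_rep V S' x \<oplus>\<^bsub>quotient_module V S'\<^esub> coset_rep V S' y"
      by (simp add: V.quotient_module_simps[OF S] V.quotient_module_simps[OF S'] rr
          V.M.coset_rep_add_left[OF sub'] V.M.coset_rep_add_right[OF sub'] V.M.coset_rep_props(1)[OF sub'])
  next
    fix a x assume "a \<in> carrier R" "x \<in> carrier (quotient_module V S)"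
    moreover then have "x \<in> carrier V"
      by (auto simp: V.quotient_module_simps[OF S] V.M.coset_rep_props(1)[OF sub])
    ultimately show "coset_rep V S' (a \<odot>\<^bsub>quotient_module V S\<^esub> x) =
        a \<odot>\<^bsub>quotient_module V S'\<^esub> coset_rep V S' x"
      by (simp add: V.quotient_module_simps[OF S] V.quotient_module_simps[OF S'] rr
          V.coset_rep_smult_rep[OF S'] V.smult_closed)
  qed (auto simp: V.quotient_module_simps[OF S] V.quotient_module_simps[OF S']
      V.M.coset_rep_props(1)[OF sub])
  then have "(\<lambda>u. coset_rep V S' (coset_rep V S (f u))) \<in> continuous_hom R U (quotient_module V S')"
    by (rule continuous_hom_compose[OF lift_moduloD(2)[OF f]])
  then have "(\<lambda>u. coset_rep V S' (f u)) \<in> continuous_hom R U (quotient_module V S')"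
  proof (rule continuous_hom_cong[OF _ _ profinite_U])
    fix u assume "u \<in> carrier U"
    then have "f u \<in> carrier V" by (rule PiE_mem[OF lift_moduloD(1)[OF f]])
    then show "coset_rep V S' (coset_rep V S (f u)) = coset_rep V S' (f u)" by (rule rr)
  qed
  moreover have "coset_rep W (\<beta> ` S') (\<beta> (f u)) = coset_rep W (\<beta> ` S') (\<phi> u)" if u: "u \<in> carrier U" for u
  proof (rule W.M.coset_rep_mono)
    show "subgroup (\<beta> ` S) (add_monoid W)" "subgroup (\<beta> ` S') (add_monoid W)"
      using W.open_submodule_subgroup open_submodule_image[OF profinite_V profinite_W beta surj] S S' by blast+
    show "\<beta> ` S \<subseteq> \<beta> ` S'" using le by blast
    have "f u \<in> carrier V" by (rule PiE_mem[OF lift_moduloD(1)[OF f] u])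
    then show "\<beta> (f u) \<in> carrier W" by (rule continuous_homD(1)[OF beta])
    show "\<phi> u \<in> carrier W" using u by (rule continuous_homD(1)[OF phi])
    show "coset_rep W (\<beta> ` S) (\<beta> (f u)) = coset_rep W (\<beta> ` S) (\<phi> u)"
      by (rule lift_moduloD(3)[OF f u])
  qed
  ultimately show ?thesis using lift_moduloD(1)[OF f] unfolding lift_modulo_def by (intro conjI ballI)
qed

text \<open>Since \<open>U\<close> is finitely generated, a pointwise limit of lifts modulo \<open>S\<close> agrees modulo \<open>S\<close> with
  any of these lifts that is close enough to it on the generators.\<close>

lemma closedin_lift_modulo:
  assumes S: "open_submodule R V S" and fg: "finitely_generated_profinite R U"
  shows "closedin (product_topology (\<lambda>_. mtop V) (carrier U)) {f. lift_modulo R U V W \<beta> \<phi> S f}"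
    (is "closedin ?P ?L")
proof -
  note sub = V.open_submodule_subgroup[OF S]
  obtain X where X: "finite X" "X \<subseteq> carrier U" "\<Inter>{S. closed_submodule R U S \<and> X \<subseteq> S} = carrier U"
    using fg unfolding finitely_generated_profinite_def by blast
  have top: "topspace ?P = carrier U \<rightarrow>\<^sub>E carrier V" by (simp add: V.topspace_mtop)
  have "f \<in> ?L" if f: "f \<in> ?P closure_of ?L" for f
  proof -
    have fE: "f \<in> carrier U \<rightarrow>\<^sub>E carrier V" using f top by (metis in_closure_of)
    have approx: "\<exists>g. lift_modulo R U V W \<beta> \<phi> S g \<and> (\<forall>x\<in>F. coset_rep V S (g x) = coset_rep V S (f x))"
      if F: "finite F" "F \<subseteq> carrier U" for F
    proof -
      \<comment> \<open>A basic neighbourhood of \<open>f\<close> that fixes the coset of the value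
        at the points of \<open>F\<close> and leaves all other coordinates free. It meets the set of
        lifts because \<open>f\<close> lies in the closure.\<close>
      define B where "B = (\<lambda>u. if u \<in> F then {y \<in> carrier V. coset_rep V S y = coset_rep V S (f u)} else carrier V)"
      have "openin (mtop V) (B u)" if "u \<in> carrier U" for u
        using V.openin_coset_rep[OF S PiE_mem[OF fE that]] openin_topspace[of "mtop V"]
        by (simp add: B_def V.topspace_mtop)
      moreover have "finite {u \<in> carrier U. B u \<noteq> topspace (mtop V)}"
        by (rule finite_subset[OF _ F(1)]) (auto simp: B_def V.topspace_mtop)
      ultimately have "openin ?P (Pi\<^sub>E (carrier U) B)" by (simp add: openin_PiE_gen)
      moreover have "f \<in> Pi\<^sub>E (carrier U) B"
        using fE by (auto simp: PiE_iff B_def)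
      ultimately obtain g where g: "lift_modulo R U V W \<beta> \<phi> S g" "g \<in> Pi\<^sub>E (carrier U) B"
        using f unfolding in_closure_of by blast
      have "coset_rep V S (g x) = coset_rep V S (f x)" if "x \<in> F" for x
        using PiE_mem[OF g(2), of x] that F(2) by (auto simp: B_def)
      then show ?thesis using g(1) by blast
    qed
    obtain g where g: "lift_modulo R U V W \<beta> \<phi> S g" "\<forall>x\<in>X. coset_rep V S (g x) = coset_rep V S (f x)"
      using approx[OF X(1,2)] by blast
    have "coset_rep V S (f u) = coset_rep V S (g u)" if u: "u \<in> carrier U" for u
    proof -
      \<comment> \<open>\<open>g\<close> was chosen once, from the generators; \<open>h\<close>
        depends on \<open>u\<close> and agrees with \<open>f\<close> there too. Modulo
        \<open>S\<close> both are homomorphisms equal on \<open>X\<close>, so they agree at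
        \<open>u\<close>, and hence so do \<open>f\<close> and \<open>g\<close>.\<close>
      obtain h where h: "lift_modulo R U V W \<beta> \<phi> S h"
        "\<forall>x\<in>insert u X. coset_rep V S (h x) = coset_rep V S (f x)"
        using approx[of "insert u X"] X(1,2) u by blast
      have "coset_rep V S (h u) = coset_rep V S (g u)"
      proof (rule continuous_hom_eq_if_eq_on_generators[OF profinite_U
            profinite_top_moduleI[OF V.profinite_quotient_module[OF S]]
            lift_moduloD(2)[OF h(1)] lift_moduloD(2)[OF g(1)] X(3,2) _ u])
        fix x assume x: "x \<in> X"
        then have "coset_rep V S (h x) = coset_rep V S (f x)" using h(2) by blast
        also have "\<dots> = coset_rep V S (g x)" using g(2) x by simp
        finally show "coset_rep V S (h x) = coset_rep V S (g x)" .
      qed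
      then show ?thesis using h by simp
    qed
    then show ?thesis using lift_modulo_cong[OF S g(1) fE] by blast
  qed
  then have "?P closure_of ?L \<subseteq> ?L" by blast
  moreover have "?L \<subseteq> topspace ?P" unfolding top lift_modulo_def by blast
  ultimately show ?thesis using closure_of_subset_eq by blast
qed

lemma lift_if_lift_modulo:
  assumes f: "\<And>S. open_submodule R V S \<Longrightarrow> lift_modulo R U V W \<beta> \<phi> S f"
  shows "f \<in> continuous_hom R U V" "\<And>u. u \<in> carrier U \<Longrightarrow> \<beta> (f u) = \<phi> u"
proof -
  have fE: "f u \<in> carrier V" if "u \<in> carrier U" for u
    by (rule PiE_mem[OF lift_moduloD(1)[OF f[OF V.carrier_open_submodule]] that])
  have fS: "(\<lambda>u. coset_rep V S (f u)) \<in> continuous_hom R U (quotient_module V S)" if "open_submodule R V S" for S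
    by (rule lift_moduloD(2)[OF f[OF that]])
  note simps = V.M.coset_rep_add_left[OF V.open_submodule_subgroup]
    V.M.coset_rep_add_right[OF V.open_submodule_subgroup] V.coset_rep_smult_rep
    V.M.coset_rep_props(1)[OF V.open_submodule_subgroup]
  show "f \<in> continuous_hom R U V"
  proof (rule continuous_homI)
    show "f u \<in> carrier V" if "u \<in> carrier U" for u using fE[OF that] .
  next
    fix x y assume xy: "x \<in> carrier U" "y \<in> carrier U"
    show "f (x \<oplus>\<^bsub>U\<^esub> y) = f x \<oplus>\<^bsub>V\<^esub> f y"
    proof (rule V.eq_if_coset_rep_eq[OF compact_RT topspace_RT])
      fix S assume S: "open_submodule R V S"
      show "coset_rep V S (f (x \<oplus>\<^bsub>U\<^esub> y)) = coset_rep V S (f x \<oplus>\<^bsub>V\<^esub> f y)"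
        using continuous_homD(2)[OF fS[OF S] xy] fE xy S
        by (simp add: V.quotient_module_simps[OF S] simps)
    qed (use xy fE in auto)
  next
    fix a x assume ax: "a \<in> carrier R" "x \<in> carrier U"
    show "f (a \<odot>\<^bsub>U\<^esub> x) = a \<odot>\<^bsub>V\<^esub> f x"
    proof (rule V.eq_if_coset_rep_eq[OF compact_RT topspace_RT])
      fix S assume S: "open_submodule R V S"
      show "coset_rep V S (f (a \<odot>\<^bsub>U\<^esub> x)) = coset_rep V S (a \<odot>\<^bsub>V\<^esub> f x)"
        using continuous_homD(3)[OF fS[OF S] ax] fE ax S
        by (simp add: V.quotient_module_simps[OF S] simps)
    qed (use ax fE U.smult_closed V.smult_closed in auto)
  next
    \<comment> \<open>Cosets of open submodules form a base of \<open>V\<close>, and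
      \<open>f\<close> is locally constant modulo each open submodule.\<close>
    show "continuous_map (mtop U) (mtop V) f"
    proof (unfold continuous_map_def, intro conjI allI impI)
      show "f \<in> topspace (mtop U) \<rightarrow> topspace (mtop V)"
        using fE by (simp add: U.topspace_mtop V.topspace_mtop)
      fix O' assume O': "openin (mtop V) O'"
      have "\<exists>A. openin (mtop U) A \<and> u \<in> A \<and> A \<subseteq> {x \<in> topspace (mtop U). f x \<in> O'}"
        if u: "u \<in> {x \<in> topspace (mtop U). f x \<in> O'}" for u
      proof -
        have uU: "u \<in> carrier U" and fu: "f u \<in> O'" using u by (simp_all add: U.topspace_mtop)
        obtain S where S: "open_submodule R V S"
          "\<forall>y \<in> carrier V. coset_rep V S y = coset_rep V S (f u) \<longrightarrow> y \<in> O'"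
          by (rule V.open_submodule_base[OF compact_RT topspace_RT O' fu])
        have "openin (mtop U) {x \<in> topspace (mtop U). coset_rep V S (f x) = coset_rep V S (f u)}"
          using continuous_homD(4)[OF fS[OF S(1)]] uU
          unfolding V.quotient_module_simps[OF S(1)] continuous_map_discrete_iff U.topspace_mtop by blast
        then show ?thesis
          using S(2) fE uU
          by (intro exI[of _ "{x \<in> topspace (mtop U). coset_rep V S (f x) = coset_rep V S (f u)}"])
            (auto simp: U.topspace_mtop)
      qed
      then show "openin (mtop U) {x \<in> topspace (mtop U). f x \<in> O'}"
        by (subst openin_subopen) blast
    qed
  qed
  fix u assume u: "u \<in> carrier U"
  have bW: "\<beta> (f u) \<in> carrier W" and \<phi>W: "\<phi> u \<in> carrier W"
    using fE[OF u] u continuous_homD(1)[OF beta] continuous_homD(1)[OF phi] by blast+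
  define w where "w = \<beta> (f u) \<ominus>\<^bsub>W\<^esub> \<phi> u"
  have wW: "w \<in> carrier W" using bW \<phi>W by (simp add: w_def)
  have wS: "w \<in> \<beta> ` S" if S: "open_submodule R V S" for S
    using lift_moduloD(3)[OF f[OF S] u] bW \<phi>W
      W.M.coset_rep_eq_iff[OF W.open_submodule_subgroup[OF open_submodule_image[OF profinite_V profinite_W beta surj S]]]
    unfolding w_def by simp
  have "w = \<zero>\<^bsub>W\<^esub>"
  proof (rule ccontr)
    assume "w \<noteq> \<zero>\<^bsub>W\<^esub>"
    have "closedin (mtop W) {w}"
      using W.additive.Hausdorff wW by (simp add: closedin_Hausdorff_singleton W.topspace_mtop)
    then have "openin (mtop W) (topspace (mtop W) - {w})" by blast
    then have o: "openin (mtop V) {v \<in> topspace (mtop V). \<beta> v \<in> topspace (mtop W) - {w}}"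
      by (rule openin_continuous_map_preimage[OF continuous_homD(4)[OF beta]])
    have "\<beta> \<zero>\<^bsub>V\<^esub> = \<zero>\<^bsub>W\<^esub>"
      using group_hom.hom_one[OF continuous_hom_group_hom[OF profinite_V profinite_W beta]] by simp
    then have "\<zero>\<^bsub>V\<^esub> \<in> {v \<in> topspace (mtop V). \<beta> v \<in> topspace (mtop W) - {w}}"
      using \<open>w \<noteq> \<zero>\<^bsub>W\<^esub>\<close> by (simp add: V.topspace_mtop W.topspace_mtop)
    with o obtain S where S: "open_submodule R V S"
      "S \<subseteq> {v \<in> topspace (mtop V). \<beta> v \<in> topspace (mtop W) - {w}}"
      by (rule V.open_submodule_base_zero[OF compact_RT topspace_RT])
    then show False using wS[OF S(1)] by blast
  qed
  moreover have "\<beta> (f u) = w \<oplus>\<^bsub>W\<^esub> \<phi> u"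
    using bW \<phi>W by (simp add: w_def a_minus_def W.M.a_assoc W.M.l_neg)
  ultimately show "\<beta> (f u) = \<phi> u" using \<phi>W by simp
qed

text \<open>By Tychonoff the space of maps \<open>U \<rightarrow> V\<close> is compact. The lifts
  modulo the various \<open>S\<close> form closed sets with the finite intersection property, and a
  common point is an actual lift.\<close>

lemma lift_exists_if_lift_modulo:
  assumes fg: "finitely_generated_profinite R U"
    and ex: "\<And>S. open_submodule R V S \<Longrightarrow> \<exists>f. lift_modulo R U V W \<beta> \<phi> S f"
  shows "\<exists>\<rho> \<in> continuous_hom R U V. \<forall>u \<in> carrier U. \<beta> (\<rho> u) = \<phi> u"
proof -
  let ?P = "product_topology (\<lambda>_. mtop V) (carrier U)"
  let ?L = "\<lambda>S. {f. lift_modulo R U V W \<beta> \<phi> S f}"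
  let ?C = "?L ` {S. open_submodule R V S}"
  have "compact_space ?P"
    unfolding compact_space_product_topology using V.additive.compact by blast
  moreover have "\<forall>C\<in>?C. closedin ?P C" using closedin_lift_modulo[OF _ fg] by blast
  moreover have "\<Inter>F \<noteq> {}" if F: "finite F" "F \<subseteq> ?C" for F
  proof -
    obtain F' where F': "F' \<subseteq> {S. open_submodule R V S}" "finite F'" "F = ?L ` F'"
      using finite_subset_image[OF F] by blast
    have "\<exists>S. open_submodule R V S \<and> (\<forall>S'\<in>F'. S \<subseteq> S')"
      using V.Inter_open_submodule[OF F'(2)] F'(1) by blast
    then obtain S where S: "open_submodule R V S" "\<forall>S'\<in>F'. S \<subseteq> S'" by blast
    obtain f where f: "lift_modulo R U V W \<beta> \<phi> S f" using ex[OF S(1)] by blast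
    have "lift_modulo R U V W \<beta> \<phi> S' f" if "S' \<in> F'" for S'
      using lift_modulo_mono[OF S(1) _ _ f] that S(2) F'(1) by blast
    then have "f \<in> \<Inter>F" unfolding F'(3) by blast
    then show ?thesis by blast
  qed
  ultimately have "\<Inter>?C \<noteq> {}" unfolding compact_space_fip by blast
  then obtain f where "\<And>S. open_submodule R V S \<Longrightarrow> lift_modulo R U V W \<beta> \<phi> S f" by blast
  from lift_if_lift_modulo[OF this] show ?thesis by blast
qed

end


section \<open>Relative projectivity\<close>

lemma restrict_scalars_simps [simp]:
  "carrier (restrict_scalars i M) = carrier M"
  "mtop (restrict_scalars i M) = mtop M"
  "x \<oplus>\<^bsub>restrict_scalars i M\<^esub> y = x \<oplus>\<^bsub>M\<^esub> y"
  "a \<odot>\<^bsub>restrict_scalars i M\<^esub> x = i a \<odot>\<^bsub>M\<^esub> x"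
  by (simp_all add: restrict_scalars_def)

lemma relatively_projectiveD:
  assumes "relatively_projective TYPE('v) TYPE('w) G T H U"
    and "profinite_cga_module G T (V :: ('g set \<Rightarrow> 'g set \<Rightarrow> 'k::comm_ring_1, 'v) top_module)"
    and "profinite_cga_module G T (W :: ('g set \<Rightarrow> 'g set \<Rightarrow> 'k, 'w) top_module)"
    and "\<beta> \<in> continuous_hom (completed_group_algebra G T) V W" "\<beta> ` carrier V = carrier W"
    and "\<phi> \<in> continuous_hom (completed_group_algebra G T) U W"
    and "\<rho> \<in> continuous_hom (completed_group_algebra (G\<lparr>carrier := H\<rparr>) (subtopology T H))
           (restrict_scalars (completed_inclusion G T H) U)
           (restrict_scalars (completed_inclusion G T H) V)"
    and "\<And>u. u \<in> carrier U \<Longrightarrow> \<beta> (\<rho> u) = \<phi> u"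
  shows "\<exists>\<rho> \<in> continuous_hom (completed_group_algebra G T) U V. \<forall>u \<in> carrier U. \<beta> (\<rho> u) = \<phi> u"
  using assms(1)[unfolded relatively_projective_def, rule_format, OF assms(2-6)] assms(7,8) by blast

text \<open>The map \<open>k[[H]] \<rightarrow> k[[G]]\<close> factors through
  \<open>k[[K]]\<close>, so a given \<open>k[[K]]\<close>-lift is already a
  \<open>k[[H]]\<close>-lift and the hypothesis applies to it.\<close>

lemma (in group) relatively_projective_supergroup:
  assumes H: "subgroup H G" and K: "subgroup K G" and "H \<subseteq> K"
    and proj: "relatively_projective TYPE('v) TYPE('w) G T H U"
  shows "relatively_projective TYPE('v) TYPE('w) G T K
    (U :: ('a set \<Rightarrow> 'a set \<Rightarrow> 'k::comm_ring_1, 'u) top_module)"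
  unfolding relatively_projective_def
proof (intro allI impI, elim bexE)
  fix V :: "('a set \<Rightarrow> 'a set \<Rightarrow> 'k, 'v) top_module" and W :: "('a set \<Rightarrow> 'a set \<Rightarrow> 'k, 'w) top_module"
    and \<beta> \<phi> \<rho>
  let ?R = "completed_group_algebra G T :: ('a set \<Rightarrow> 'a set \<Rightarrow> 'k) ring"
  assume mods: "profinite_cga_module G T V" "profinite_cga_module G T W"
    "\<beta> \<in> continuous_hom ?R V W" "\<beta> ` carrier V = carrier W" "\<phi> \<in> continuous_hom ?R U W"
    and \<rho>: "\<rho> \<in> continuous_hom (completed_group_algebra (G\<lparr>carrier := K\<rparr>) (subtopology T K))
       (restrict_scalars (completed_inclusion G T K) U) (restrict_scalars (completed_inclusion G T K) V)"
    and lift: "\<forall>u\<in>carrier U. \<beta> (\<rho> u) = \<phi> u"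
  have "\<rho> \<in> continuous_hom (completed_group_algebra (G\<lparr>carrier := H\<rparr>) (subtopology T H))
       (restrict_scalars (completed_inclusion G T H) U) (restrict_scalars (completed_inclusion G T H) V)"
  proof (rule continuous_homI)
    fix a :: "'a set \<Rightarrow> 'a set \<Rightarrow> 'k" and x
    assume a: "a \<in> carrier (completed_group_algebra (G\<lparr>carrier := H\<rparr>) (subtopology T H))"
      and x: "x \<in> carrier (restrict_scalars (completed_inclusion G T H) U)"
    define b where "b = completed_inclusion (G\<lparr>carrier := K\<rparr>) (subtopology T K) H a"
    interpret K: group "G\<lparr>carrier := K\<rparr>" by (rule subgroup_imp_group[OF K])
    have HK: "subgroup H (G\<lparr>carrier := K\<rparr>)" using subgroup_incl[OF H K \<open>H \<subseteq> K\<close>] .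
    have "subtopology (subtopology T K) H = subtopology T H"
      using \<open>H \<subseteq> K\<close> by (simp add: subtopology_subtopology inf_absorb2)
    then have "b \<in> carrier (completed_group_algebra (G\<lparr>carrier := K\<rparr>) (subtopology T K))"
      unfolding b_def using a by (intro K.completed_inclusion_closed[OF HK]) simp
    moreover have "completed_inclusion G T K b = completed_inclusion G T H a"
      unfolding b_def by (rule completed_inclusion_trans[OF H K \<open>H \<subseteq> K\<close> a])
    ultimately show "\<rho> (a \<odot>\<^bsub>restrict_scalars (completed_inclusion G T H) U\<^esub> x) =
        a \<odot>\<^bsub>restrict_scalars (completed_inclusion G T H) V\<^esub> \<rho> x"
      using continuous_homD(3)[OF \<rho>, of b x] x by simp
  qed (use continuous_homD(1,2,4)[OF \<rho>] in simp_all)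
  then show "\<exists>\<rho>\<in>continuous_hom ?R U V. \<forall>u\<in>carrier U. \<beta> (\<rho> u) = \<phi> u"
    by (rule relatively_projectiveD[OF proj mods]) (use lift in blast)
qed

text \<open>Supplies the epimorphism \<open>V/S \<rightarrow> W/\<beta>(S)\<close> to which relative
  projectivity is applied.\<close>

lemma (in lifting_problem) beta_quotient_module:
  assumes S: "open_submodule R V S"
  shows "(\<lambda>x. coset_rep W (\<beta> ` S) (\<beta> x)) \<in>
      continuous_hom R (quotient_module V S) (quotient_module W (\<beta> ` S))"
    and "(\<lambda>x. coset_rep W (\<beta> ` S) (\<beta> x)) ` carrier (quotient_module V S) =
      carrier (quotient_module W (\<beta> ` S))"
proof -
  have S': "open_submodule R W (\<beta> ` S)" by (rule open_submodule_image[OF profinite_V profinite_W beta surj S])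
  note sub = V.open_submodule_subgroup[OF S] and sub' = W.open_submodule_subgroup[OF S']
  let ?Q = "quotient_module V S" and ?r = "coset_rep W (\<beta> ` S)"
  have QV: "x \<in> carrier V" if "x \<in> carrier ?Q" for x
    using that by (auto simp: V.quotient_module_simps[OF S] V.M.coset_rep_props(1)[OF sub])
  have br: "?r (\<beta> (coset_rep V S x)) = ?r (\<beta> x)" if "x \<in> carrier V" for x
    by (rule beta_coset_rep[OF S V.M.coset_rep_props(1)[OF sub that] that V.M.coset_rep_idem[OF sub that]])
  note [simp] = continuous_homD(1)[OF beta] continuous_homD(2,3)[OF beta] br
  show "(\<lambda>x. ?r (\<beta> x)) \<in> continuous_hom R ?Q (quotient_module W (\<beta> ` S))"
  proof (rule continuous_homI)
    fix x y assume "x \<in> carrier ?Q" "y \<in> carrier ?Q"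
    then show "?r (\<beta> (x \<oplus>\<^bsub>?Q\<^esub> y)) = ?r (\<beta> x) \<oplus>\<^bsub>quotient_module W (\<beta> ` S)\<^esub> ?r (\<beta> y)"
      using QV[of x] QV[of y]
      by (simp add: V.quotient_module_simps[OF S] W.quotient_module_simps[OF S']
          W.M.coset_rep_add_left[OF sub'] W.M.coset_rep_add_right[OF sub'] W.M.coset_rep_props(1)[OF sub'])
  next
    fix a x assume "a \<in> carrier R" "x \<in> carrier ?Q"
    then show "?r (\<beta> (a \<odot>\<^bsub>?Q\<^esub> x)) = a \<odot>\<^bsub>quotient_module W (\<beta> ` S)\<^esub> ?r (\<beta> x)"
      using QV[of x]
      by (simp add: V.quotient_module_simps[OF S] W.quotient_module_simps[OF S']
          W.coset_rep_smult_rep[OF S'] V.smult_closed)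
  qed (use QV in \<open>auto simp: V.quotient_module_simps[OF S] W.quotient_module_simps[OF S']\<close>)
  have "(\<lambda>x. ?r (\<beta> x)) ` carrier ?Q = (\<lambda>x. ?r (\<beta> x)) ` carrier V"
    unfolding V.quotient_module_simps[OF S] image_image by (rule image_cong[OF refl br])
  also have "\<dots> = ?r ` carrier W" unfolding surj[symmetric] image_image ..
  finally show "(\<lambda>x. ?r (\<beta> x)) ` carrier ?Q = carrier (quotient_module W (\<beta> ` S))"
    unfolding W.quotient_module_simps[OF S'] .
qed

text \<open>After reduction modulo \<open>S\<close> the \<open>k[[H]]\<close>-lift
  \<open>\<rho>\<close> becomes linear over \<open>k[[H N]]\<close>, once \<open>N\<close> is small
  enough for the actions on quotients of both \<open>U\<close> and \<open>V\<close>. Relative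
  projectivity for this one \<open>H N\<close> then suffices.\<close>

lemma (in profinite_group) lift_modulo_exists:
  fixes U :: "('g set \<Rightarrow> 'g set \<Rightarrow> 'k::{comm_ring_1, finite}, 'u) top_module"
    and V :: "('g set \<Rightarrow> 'g set \<Rightarrow> 'k, 'v) top_module"
    and W :: "('g set \<Rightarrow> 'g set \<Rightarrow> 'k, 'w) top_module"
  assumes H: "subgroup H G"
    and proj: "\<And>N. N \<in> open_normal G T \<Longrightarrow> relatively_projective TYPE('v) TYPE('w) G T (H <#> N) U"
    and lp: "lifting_problem (completed_group_algebra G T) (completed_group_algebra_topology G T) U V W \<beta> \<phi>"
    and \<rho>: "\<rho> \<in> continuous_hom (completed_group_algebra (G\<lparr>carrier := H\<rparr>) (subtopology T H))
       (restrict_scalars (completed_inclusion G T H) U) (restrict_scalars (completed_inclusion G T H) V)"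
    and lift: "\<And>u. u \<in> carrier U \<Longrightarrow> \<beta> (\<rho> u) = \<phi> u"
    and S: "open_submodule (completed_group_algebra G T) V S"
  shows "\<exists>f. lift_modulo (completed_group_algebra G T) U V W \<beta> \<phi> S f"
proof -
  let ?R = "completed_group_algebra G T :: ('g set \<Rightarrow> 'g set \<Rightarrow> 'k) ring"
  let ?RT = "completed_group_algebra_topology G T :: ('g set \<Rightarrow> 'g set \<Rightarrow> 'k) topology"
  interpret lifting_problem ?R ?RT U V W \<beta> \<phi> by (rule lp)
  have S': "open_submodule ?R W (\<beta> ` S)" by (rule open_submodule_image[OF profinite_V profinite_W beta surj S])
  note sub = V.open_submodule_subgroup[OF S]
  let ?Q = "quotient_module V S"
  let ?q = "coset_rep V S" and ?r = "coset_rep W (\<beta> ` S)"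
  have \<rho>V: "\<rho> u \<in> carrier V" if "u \<in> carrier U" for u
    using continuous_homD(1)[OF \<rho>] that by simp
  have \<rho>add: "\<rho> (x \<oplus>\<^bsub>U\<^esub> y) = \<rho> x \<oplus>\<^bsub>V\<^esub> \<rho> y" if "x \<in> carrier U" "y \<in> carrier U" for x y
    using continuous_homD(2)[OF \<rho>] that by simp
  have \<rho>cont: "continuous_map (mtop U) (mtop V) \<rho>"
    using continuous_homD(4)[OF \<rho>] by simp
  have qcont: "continuous_map (mtop U) (discrete_topology (?q ` carrier V)) (\<lambda>u. ?q (\<rho> u))"
    using continuous_map_compose[OF \<rho>cont V.continuous_coset_rep[OF S]] by (simp add: o_def)
  have \<rho>0: "\<rho> \<zero>\<^bsub>U\<^esub> = \<zero>\<^bsub>V\<^esub>"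
    using \<rho>add[of "\<zero>\<^bsub>U\<^esub>" "\<zero>\<^bsub>U\<^esub>"] \<rho>V[of "\<zero>\<^bsub>U\<^esub>"] by (simp add: V.M.add.l_cancel_one')
  \<comment> \<open>\<open>\<rho>\<close> is linear over \<open>k[[H]]\<close> only, so the set
    where it vanishes modulo \<open>S\<close> need not be stable under \<open>k[[G]]\<close>. An
    open \<open>k[[G]]\<close>-submodule \<open>K\<close> inside it is, and \<open>\<rho>\<close>
    modulo \<open>S\<close> factors through \<open>U/K\<close>.\<close>
  obtain K where K: "open_submodule ?R U K" "K \<subseteq> {u \<in> topspace (mtop U). ?q (\<rho> u) = ?q (\<rho> \<zero>\<^bsub>U\<^esub>)}"
  proof (rule U.open_submodule_base_zero[OF compact_RT topspace_RT])
    show "openin (mtop U) {u \<in> topspace (mtop U). ?q (\<rho> u) = ?q (\<rho> \<zero>\<^bsub>U\<^esub>)}"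
      using qcont unfolding continuous_map_discrete_iff U.topspace_mtop by blast
    show "\<zero>\<^bsub>U\<^esub> \<in> {u \<in> topspace (mtop U). ?q (\<rho> u) = ?q (\<rho> \<zero>\<^bsub>U\<^esub>)}"
      by (simp add: U.topspace_mtop)
  qed
  have q\<rho>_cong: "?q (\<rho> x) = ?q (\<rho> y)"
    if xy: "x \<in> carrier U" "y \<in> carrier U" "coset_rep U K x = coset_rep U K y" for x y
  proof -
    have "x \<ominus>\<^bsub>U\<^esub> y \<in> K"
      using xy U.M.coset_rep_eq_iff[OF U.open_submodule_subgroup[OF K(1)]] by blast
    then have 0: "?q (\<rho> (x \<ominus>\<^bsub>U\<^esub> y)) = ?q \<zero>\<^bsub>V\<^esub>" using K(2) \<rho>0 by auto
    have "x = (x \<ominus>\<^bsub>U\<^esub> y) \<oplus>\<^bsub>U\<^esub> y"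
      using xy by (simp add: a_minus_def U.M.a_assoc U.M.l_neg)
    then have "\<rho> x = \<rho> (x \<ominus>\<^bsub>U\<^esub> y) \<oplus>\<^bsub>V\<^esub> \<rho> y"
      using \<rho>add[of "x \<ominus>\<^bsub>U\<^esub> y" y] xy by simp
    also have "?q \<dots> = ?q (\<zero>\<^bsub>V\<^esub> \<oplus>\<^bsub>V\<^esub> \<rho> y)"
      using xy \<rho>V by (intro V.M.coset_rep_add_cong[OF sub 0]) simp_all
    finally show ?thesis using \<rho>V xy by simp
  qed
  have Um: "profinite_cga_module G T U" and Vm: "profinite_cga_module G T V" ..
  obtain N1 where N1: "N1 \<in> open_normal G T"
    "\<And>a b x. \<lbrakk>a \<in> carrier ?R; b \<in> carrier ?R; a N1 = b N1; x \<in> carrier U\<rbrakk> \<Longrightarrow>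
      coset_rep U K (a \<odot>\<^bsub>U\<^esub> x) = coset_rep U K (b \<odot>\<^bsub>U\<^esub> x)"
    by (rule smult_factors_open_normal[OF Um K(1)]) blast
  obtain N2 where N2: "N2 \<in> open_normal G T"
    "\<And>a b x. \<lbrakk>a \<in> carrier ?R; b \<in> carrier ?R; a N2 = b N2; x \<in> carrier V\<rbrakk> \<Longrightarrow>
      ?q (a \<odot>\<^bsub>V\<^esub> x) = ?q (b \<odot>\<^bsub>V\<^esub> x)"
    by (rule smult_factors_open_normal[OF Vm S]) blast
  \<comment> \<open>At level \<open>N\<close> a scalar determines its action both on
    \<open>U/K\<close> and on \<open>V/S\<close>.\<close>
  define N where "N = N1 \<inter> N2"
  have N: "N \<in> open_normal G T"
    using N1(1) N2(1) by (auto simp: N_def open_normal_def normal_subgroup_intersect)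
  have NM: "a M = b M"
    if "a \<in> carrier ?R" "b \<in> carrier ?R" "a N = b N" "M \<in> open_normal G T" "N \<subseteq> M" for a b M
  proof -
    have "group_algebra_map (\<lambda>C. M <#> C) (c N) = c M" if "c \<in> carrier ?R" for c
      using that N \<open>M \<in> open_normal G T\<close> \<open>N \<subseteq> M\<close> by (simp add: carrier_cga)
    from this[of a] this[of b] show ?thesis using that by simp
  qed
  have HN: "subgroup (H <#> N) G"
    using mult_norm_subgroup[of N H] commut_normal[OF H, of N] H N by (simp add: open_normal_def)
  have "(\<lambda>u. ?q (\<rho> u)) \<in>
      continuous_hom (completed_group_algebra (G\<lparr>carrier := H <#> N\<rparr>) (subtopology T (H <#> N)))
       (restrict_scalars (completed_inclusion G T (H <#> N)) U)
       (restrict_scalars (completed_inclusion G T (H <#> N)) ?Q)"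
  proof (rule continuous_homI)
    fix b' :: "'g set \<Rightarrow> 'g set \<Rightarrow> 'k" and u
    assume b': "b' \<in> carrier (completed_group_algebra (G\<lparr>carrier := H <#> N\<rparr>) (subtopology T (H <#> N)))"
      and "u \<in> carrier (restrict_scalars (completed_inclusion G T (H <#> N)) U)"
    then have u: "u \<in> carrier U" by simp
    obtain a' where a': "a' \<in> carrier (completed_group_algebra (G\<lparr>carrier := H\<rparr>) (subtopology T H))"
      "completed_inclusion G T H a' N = completed_inclusion G T (H <#> N) b' N"
      by (rule completed_inclusion_approx[OF H N b'])
    define a where "a = completed_inclusion G T H a'"
    define b where "b = completed_inclusion G T (H <#> N) b'"
    have ab: "a \<in> carrier ?R" "b \<in> carrier ?R" "a N = b N"
      unfolding a_def b_def
      by (rule completed_inclusion_closed[OF H a'(1)], rule completed_inclusion_closed[OF HN b'], rule a'(2))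
    \<comment> \<open>\<open>b\<close> is traded for \<open>a\<close>, which comes from
      \<open>k[[H]]\<close> and agrees with \<open>b\<close> at \<open>N\<close>: first inside
      \<open>U\<close> modulo \<open>K\<close>, then, after \<open>a\<close> is moved out of
      \<open>\<rho>\<close>, back to \<open>b\<close> inside \<open>V\<close> modulo
      \<open>S\<close>.\<close>
    have "?q (\<rho> (b \<odot>\<^bsub>U\<^esub> u)) = ?q (\<rho> (a \<odot>\<^bsub>U\<^esub> u))"
      using ab u NM[OF ab N1(1)] N1(2)[of b a u] U.smult_closed
      by (intro q\<rho>_cong) (simp_all add: N_def)
    also have "\<rho> (a \<odot>\<^bsub>U\<^esub> u) = a \<odot>\<^bsub>V\<^esub> \<rho> u"
      using continuous_homD(3)[OF \<rho> a'(1), of u] u by (simp add: a_def)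
    also have "?q (a \<odot>\<^bsub>V\<^esub> \<rho> u) = ?q (b \<odot>\<^bsub>V\<^esub> \<rho> u)"
      using ab \<rho>V[OF u] NM[OF ab N2(1)] by (intro N2(2)) (simp_all add: N_def)
    also have "\<dots> = b \<odot>\<^bsub>?Q\<^esub> ?q (\<rho> u)"
      using ab \<rho>V[OF u] by (simp add: V.quotient_module_simps[OF S] V.coset_rep_smult_rep[OF S])
    finally show "?q (\<rho> (b' \<odot>\<^bsub>restrict_scalars (completed_inclusion G T (H <#> N)) U\<^esub> u)) =
        b' \<odot>\<^bsub>restrict_scalars (completed_inclusion G T (H <#> N)) ?Q\<^esub> ?q (\<rho> u)"
      by (simp add: b_def)
  qed (use qcont \<rho>V \<rho>add in \<open>simp_all add: V.quotient_module_simps[OF S] V.M.coset_rep_add_left[OF sub]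
      V.M.coset_rep_add_right[OF sub] V.M.coset_rep_props(1)[OF sub]\<close>)
  moreover have "?r (\<beta> (?q (\<rho> u))) = ?r (\<phi> u)" if u: "u \<in> carrier U" for u
    using beta_coset_rep[OF S V.M.coset_rep_props(1)[OF sub \<rho>V[OF u]] \<rho>V[OF u]
        V.M.coset_rep_idem[OF sub \<rho>V[OF u]]] lift[OF u] by simp
  \<comment> \<open>The hypothesis for \<open>H N\<close> is applied to \<open>V/S\<close> and
    \<open>W/\<beta>(S)\<close>, which have the element types of \<open>V\<close> and
    \<open>W\<close>.\<close>
  ultimately obtain \<tau> where \<tau>: "\<tau> \<in> continuous_hom ?R U ?Q" "\<forall>u\<in>carrier U. ?r (\<beta> (\<tau> u)) = ?r (\<phi> u)"
    using relatively_projectiveD[OF proj[OF N] V.profinite_quotient_module[OF S]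
        W.profinite_quotient_module[OF S'] beta_quotient_module[OF S]
        continuous_hom_compose[OF phi W.coset_rep_continuous_hom[OF S']]] by blast
  have \<tau>V: "\<tau> u \<in> carrier V" "?q (\<tau> u) = \<tau> u" if u: "u \<in> carrier U" for u
    using continuous_homD(1)[OF \<tau>(1) u] V.M.coset_rep_idem[OF sub]
    by (auto simp: V.quotient_module_simps[OF S] V.M.coset_rep_props(1)[OF sub])
  \<comment> \<open>Values of \<open>\<tau>\<close> are representatives and so already elements of
    \<open>V\<close> fixed by the reduction; the restriction makes \<open>\<tau>\<close>
    extensional, as \<open>lift_modulo\<close> demands.\<close>
  have "(\<lambda>u. ?q (restrict \<tau> (carrier U) u)) \<in> continuous_hom ?R U ?Q"
    by (rule continuous_hom_cong[OF \<tau>(1) _ profinite_U]) (simp add: \<tau>V)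
  then have "lift_modulo ?R U V W \<beta> \<phi> S (restrict \<tau> (carrier U))"
    using \<tau>(2) \<tau>V(1) by (simp add: lift_modulo_def)
  then show ?thesis by blast
qed

theorem proposition3p3:
  fixes p :: nat
    and G :: "('g, 'n) monoid_scheme" and T :: "'g topology"
    and U :: "('g set \<Rightarrow> 'g set \<Rightarrow> 'k::{field, finite}, 'u) top_module"
    and H :: "'g set"
  assumes "CHAR('k) = p"
    and "profinite_group G T"
    and "profinite_cga_module G T U"
    and "finitely_generated_profinite (completed_group_algebra G T :: ('g set \<Rightarrow> 'g set \<Rightarrow> 'k) ring) U"
    and "subgroup H G" and "closedin T H"
  shows "relatively_projective TYPE('v) TYPE('w) G T H U \<longleftrightarrow>
    (\<forall>N. N \<lhd> G \<and> openin T N \<longrightarrow>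
      relatively_projective TYPE('v) TYPE('w) G T (H <#>\<^bsub>G\<^esub> N) U)"
proof -
  interpret profinite_group G T by fact
  note H = \<open>subgroup H G\<close>
  let ?R = "completed_group_algebra G T :: ('g set \<Rightarrow> 'g set \<Rightarrow> 'k) ring"
  let ?RT = "completed_group_algebra_topology G T :: ('g set \<Rightarrow> 'g set \<Rightarrow> 'k) topology"
  show ?thesis
  proof (intro iffI allI impI)
    fix N assume proj: "relatively_projective TYPE('v) TYPE('w) G T H U" and "N \<lhd> G \<and> openin T N"
    then have N: "N \<lhd> G" by blast
    have "subgroup (H <#>\<^bsub>G\<^esub> N) G"
      using mult_norm_subgroup[OF N H] commut_normal[OF H N] by simp
    moreover have "H \<subseteq> H <#>\<^bsub>G\<^esub> N"
    proof
      fix h assume h: "h \<in> H"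
      then have "h \<otimes>\<^bsub>G\<^esub> \<one>\<^bsub>G\<^esub> = h" using subgroup.mem_carrier[OF H] by simp
      then show "h \<in> H <#>\<^bsub>G\<^esub> N"
        using h subgroup.one_closed[OF normal_imp_subgroup[OF N]] unfolding set_mult_def by force
    qed
    ultimately show "relatively_projective TYPE('v) TYPE('w) G T (H <#>\<^bsub>G\<^esub> N) U"
      using relatively_projective_supergroup[OF H _ _ proj] by blast
  next
    assume "\<forall>N. N \<lhd> G \<and> openin T N \<longrightarrow> relatively_projective TYPE('v) TYPE('w) G T (H <#>\<^bsub>G\<^esub> N) U"
    then have proj: "relatively_projective TYPE('v) TYPE('w) G T (H <#>\<^bsub>G\<^esub> N) U" if "N \<in> open_normal G T" for N
      using that by (simp add: open_normal_def)
    show "relatively_projective TYPE('v) TYPE('w) G T H U"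
      unfolding relatively_projective_def
    proof (intro allI impI, elim bexE)
      fix V :: "('g set \<Rightarrow> 'g set \<Rightarrow> 'k, 'v) top_module"
        and W :: "('g set \<Rightarrow> 'g set \<Rightarrow> 'k, 'w) top_module" and \<beta> \<phi> \<rho>
      assume V: "profinite_cga_module G T V" and W: "profinite_cga_module G T W"
        and \<beta>: "\<beta> \<in> continuous_hom ?R V W" "\<beta> ` carrier V = carrier W"
        and \<phi>: "\<phi> \<in> continuous_hom ?R U W"
        and \<rho>: "\<rho> \<in> continuous_hom (completed_group_algebra (G\<lparr>carrier := H\<rparr>) (subtopology T H))
          (restrict_scalars (completed_inclusion G T H) U) (restrict_scalars (completed_inclusion G T H) V)"
        and lift: "\<forall>u\<in>carrier U. \<beta> (\<rho> u) = \<phi> u"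
      \<comment> \<open>Finiteness of \<open>k\<close> enters through
        \<open>compact_cga\<close>.\<close>
      have lp: "lifting_problem ?R ?RT U V W \<beta> \<phi>"
        by (intro lifting_problem.intro lifting_problem_axioms.intro profinite_top_moduleI
            assms(3) V W \<beta> \<phi> compact_cga topspace_cga_topology)
      show "\<exists>\<rho>\<in>continuous_hom ?R U V. \<forall>u\<in>carrier U. \<beta> (\<rho> u) = \<phi> u"
        using lift
        by (intro lifting_problem.lift_exists_if_lift_modulo[OF lp assms(4)]
            lift_modulo_exists[OF H proj lp \<rho>]) auto
    qed
  qed
qed

end
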